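(* Let $d\ge 1$ and let $\mathbb{P}$ be the probability distribution on $\mathcal{P}([0,1]^d)$ described in the context. Then for every sequence $\delta_k$ of positive reals decreasing to $0$ (used to compute the limit $\delta\to 0$), $$\mathbb{P}\left\{\mu:\ \lim_{\delta\to 0}\ \liminf_{m\to\infty}\frac{\log_2 h_{m,\delta}(\mu)}{m}>0\right\}=0,$$ where the event means that the limit along the sequence exists and is positive. In particular, the lower quasi-Assouad dimension, and hence the lower Assouad dimension, are zero almost surely: $\dim_{qL}\mu=0$ and $\dim_L\mu=0$ for $\mathbb{P}$-a.e. $\mu$.
   Context: $\mathcal{P}([0,1]^d)$ is the space of Borel probability measures on $[0,1]^d$, with the weak$^*$ topology. Dyadic cubes and labels. Put $n=2^d$, $\Lambda=\{1,\dots,n\}$, $\Omega=\bigcup_{k\ge 0}\Lambda^k$ (finite words, including the empty word $\emptyset$; $|\omega|$ is the length of $\omega$). Words index the nodes of the complete $n$-ary tree and the dyadic subcubes $Q_\omega$ of $[0,1]^d$: $Q_\emptyset=[0,1]^d$, and $Q_{\omega 1},\dots,Q_{\omega n}$ are the $2^d$ dyadic cubes of side length $2^{-|\omega|-1}$ partitioning $Q_\omega$ (products of half-open intervals $[a,b)$, closed on the right when $b=1$). A measure $\mu$ corresponds to the labeled tree $T$ with node labels $m_T(\omega)=\mu(Q_\omega)$; the edge from $\omega$ to $\omega i$ is labeled by the ratio $m_T(\omega i)/m_T(\omega)$, so each node label is the product of the edge labels on the path from the root. Distribution $\mathbb{P}$. Let $X^\omega=(X^\omega_1,\dots,X^\omega_n)$,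 $\omega\in\Omega$, be independent random vectors, each uniformly distributed on the simplex $\{(x_1,\dots,x_n): x_i\ge 0,\ \sum_i x_i=1\}$. Use $X^\omega_i$ as the label of the edge from $\omega$ to $\omega i$. Almost surely this determines a unique random measure $\mu\in\mathcal{P}([0,1]^d)$ with $\mu(Q_{\omega_1\cdots\omega_k})=\prod_{j=1}^k X^{\omega_1\cdots\omega_{j-1}}_{\omega_j}$ for all words. $\mathbb{P}$ is the law of $\mu$. Central children and $h_{m,\delta}$. For $m\in\mathbb{N}$, $m\ge1$, and a word $\omega$, a central child of $\omega$ is a word $\omega'$ of length $|\omega|+m$ extending $\omega$ such that the closure of $Q_{\omega'}$ contains the center of $Q_\omega$ (there are $2^d$ of these). For $\delta>0$, $$h_{m,\delta}(\mu)=\min_{|\omega|=\lfloor m/\delta\rfloor}\ \min_{\omega'\text{ a central child of }\omega}\frac{m_T(\omega)}{m_T(\omega')},$$ where $m_T(\omega)/m_T(\omega')$ is the reciprocal of the product of the $m$ edge labels on the path from $\omega$ to $\omega'$ ($+\infty$ if this product is $0$). Lower dimensions. For $\mu\in\mathcal{P}([0,1]^d)$ and $\delta\ge0$, let $h(\mu,\delta)$ be the supremum of all $s$ for which there is $C>0$ such that for all $0<r<R^{1+\delta}\le R<1$ (for $\delta=0$ the condition is $0<r<R<1$), $\inf_{x\in\operatorname{supp}\mu}\frac{\mu(B(x,R))}{\mu(B(x,r))}\ge C\left(\frac Rr\right)^s$. Then $\dim_{qL}\mu=\lim_{\delta\to0^+}h(\mu,\delta)$ (the limit exists by monotonicity)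 and $\dim_L\mu=h(\mu,0)$. Balls are Euclidean (any equivalent metric, e.g. the supremum metric, gives the same value). *)

theory Defs
  imports "HOL-Probability.Probability"
begin

text \<open>
  The dimension is \<open>d = CARD('d)\<close>, the number of children of a node is \<open>n = 2 ^ d\<close>, the alphabet
  is \<open>{1..n}\<close>, and words are the elements of \<open>lists {1..n}\<close>; the child \<open>\<omega>i\<close> of \<open>\<omega>\<close> is \<open>\<omega> @ [i]\<close>.
\<close>

abbreviation alphabet :: "'d::finite itself \<Rightarrow> nat set" where
  "alphabet _ \<equiv> {1..2 ^ CARD('d)}"

abbreviation words :: "'d::finite itself \<Rightarrow> nat list set" where
  "words _ \<equiv> lists (alphabet TYPE('d))"


section \<open>Dyadic cubes\<close>

definition dyadic_interval :: "nat \<Rightarrow> nat \<Rightarrow> real set" where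
  "dyadic_interval k j =
     (if j + 1 = 2 ^ k then {real j / 2 ^ k .. 1} else {real j / 2 ^ k ..< (real j + 1) / 2 ^ k})"

definition dyadic_cubes :: "nat \<Rightarrow> (real ^ 'd::finite) set set" where
  "dyadic_cubes k =
     {{x. \<forall>i. x $ i \<in> dyadic_interval k (z i)} | z :: 'd \<Rightarrow> nat. \<forall>i. z i < 2 ^ k}"

text \<open>
  The enumeration of the \<open>2 ^ d\<close> dyadic subcubes of a cube by \<open>{1..2 ^ d}\<close> is arbitrary, and may
  differ from node to node.
\<close>

definition dyadic_labelling :: "(nat list \<Rightarrow> (real ^ 'd::finite) set) \<Rightarrow> bool" where
  "dyadic_labelling Q \<longleftrightarrow>
     Q [] = cbox 0 1 \<and>
     (\<forall>\<omega> \<in> words TYPE('d).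
        bij_betw (\<lambda>i. Q (\<omega> @ [i])) (alphabet TYPE('d))
          {C \<in> dyadic_cubes (length \<omega> + 1). C \<subseteq> Q \<omega>})"

text \<open>The center of a box, from the endpoints of its coordinate projections.\<close>

definition cube_center :: "(real ^ 'd::finite) set \<Rightarrow> real ^ 'd" where
  "cube_center C = (\<chi> i. (Inf ((\<lambda>x. x $ i) ` C) + Sup ((\<lambda>x. x $ i) ` C)) / 2)"

definition central_children ::
    "(nat list \<Rightarrow> (real ^ 'd::finite) set) \<Rightarrow> nat \<Rightarrow> nat list \<Rightarrow> nat list set" where
  "central_children Q m \<omega> =
     {\<omega> @ v | v. v \<in> words TYPE('d) \<and> length v = m \<and> cube_center (Q \<omega>) \<in> closure (Q (\<omega> @ v))}"


section \<open>The random measure\<close>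

text \<open>
  The space of Borel probability measures on the unit cube is \<open>prob_algebra cube_borel\<close>. Its
  \<open>\<sigma>\<close>-algebra is generated by the evaluations \<open>\<mu> \<mapsto> \<mu> A\<close>; as the cube is compact metrizable, it is
  the Borel \<open>\<sigma>\<close>-algebra of the weak* topology.
\<close>

definition cube_borel :: "(real ^ 'd::finite) measure" where
  "cube_borel = restrict_space borel (cbox 0 1)"

text \<open>
  The uniform distribution on \<open>{x. (\<forall>i. 0 \<le> x i) \<and> (\<Sum>i = 1..n. x i) = 1}\<close>: normalized
  \<open>(n - 1)\<close>-dimensional Lebesgue measure, carried to the simplex by the affine chart
  \<open>(x\<^sub>1, \<dots>, x\<^bsub>n-1\<^esub>) \<mapsto> (x\<^sub>1, \<dots>, x\<^bsub>n-1\<^esub>, 1 - x\<^sub>1 - \<dots> - x\<^bsub>n-1\<^esub>)\<close>. (An affine chart changes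
  \<open>(n - 1)\<close>-dimensional volume by a constant factor only, so the choice of chart is immaterial.)
\<close>

definition uniform_simplex :: "nat \<Rightarrow> (nat \<Rightarrow> real) measure" where
  "uniform_simplex n =
     distr
       (uniform_measure (\<Pi>\<^sub>M i\<in>{1..<n}. lborel)
          {y \<in> space (\<Pi>\<^sub>M i\<in>{1..<n}. lborel).
             (\<forall>i\<in>{1..<n}. 0 \<le> y i) \<and> (\<Sum>i\<in>{1..<n}. y i) \<le> 1})
       (\<Pi>\<^sub>M i\<in>{1..n}. borel)
       (\<lambda>y. y(n := 1 - (\<Sum>i\<in>{1..<n}. y i)))"

text \<open>
  \<open>X \<omega>\<close> is the vector of labels of the edges from \<open>\<omega>\<close> to its children, and \<open>\<mu>\<close> a random
  probability measure on the cube having the resulting cube masses almost surely.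
\<close>

definition random_cascade ::
    "'a measure \<Rightarrow> (nat list \<Rightarrow> 'a \<Rightarrow> nat \<Rightarrow> real) \<Rightarrow> (nat list \<Rightarrow> (real ^ 'd::finite) set) \<Rightarrow>
     ('a \<Rightarrow> (real ^ 'd) measure) \<Rightarrow> bool" where
  "random_cascade M X Q \<mu> \<longleftrightarrow>
     prob_space M \<and>
     prob_space.indep_vars M (\<lambda>_. \<Pi>\<^sub>M i\<in>alphabet TYPE('d). borel) X (words TYPE('d)) \<and>
     (\<forall>\<omega> \<in> words TYPE('d).
        distr M (\<Pi>\<^sub>M i\<in>alphabet TYPE('d). borel) (X \<omega>) = uniform_simplex (2 ^ CARD('d))) \<and>
     \<mu> \<in> M \<rightarrow>\<^sub>M prob_algebra cube_borel \<and>
     (AE p in M. \<forall>\<omega> \<in> words TYPE('d).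
        measure (\<mu> p) (Q \<omega>) = (\<Prod>j<length \<omega>. X (take j \<omega>) p (\<omega> ! j)))"


section \<open>Central ratios\<close>

text \<open>
  The value is \<open>\<infinity>\<close> also if both masses vanish (the edge labels are then not determined by
  \<open>\<mu>\<close>); this is a null event for the random measure.
\<close>

definition central_ratio ::
    "(nat list \<Rightarrow> (real ^ 'd::finite) set) \<Rightarrow> (real ^ 'd) measure \<Rightarrow> nat list \<Rightarrow> nat list \<Rightarrow> ereal" where
  "central_ratio Q \<mu> \<omega> \<omega>' =
     (if measure \<mu> (Q \<omega>') = 0 then \<infinity> else ereal (measure \<mu> (Q \<omega>) / measure \<mu> (Q \<omega>')))"

definition h_central ::
    "(nat list \<Rightarrow> (real ^ 'd::finite) set) \<Rightarrow> nat \<Rightarrow> real \<Rightarrow> (real ^ 'd) measure \<Rightarrow> ereal" where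
  "h_central Q m \<delta> \<mu> =
     (MIN \<omega> \<in> {\<omega> \<in> words TYPE('d). length \<omega> = nat \<lfloor>real m / \<delta>\<rfloor>}.
        MIN \<omega>' \<in> central_children Q m \<omega>. central_ratio Q \<mu> \<omega> \<omega>')"

text \<open>Only used for arguments in \<open>[1, \<infinity>]\<close>.\<close>

definition ereal_log2 :: "ereal \<Rightarrow> ereal" where
  "ereal_log2 x = (if x = \<infinity> then \<infinity> else ereal (log 2 (real_of_ereal x)))"


section \<open>Lower dimensions\<close>

text \<open>
  Measures live on the cube, so balls are cut down to \<open>space \<mu>\<close>. For \<open>\<delta> = 0\<close> the condition on
  \<open>r\<close> and \<open>R\<close> below reads \<open>0 < r < R < 1\<close>.
\<close>

definition supp :: "(real ^ 'd::finite) measure \<Rightarrow> (real ^ 'd) set" where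
  "supp \<mu> = {x \<in> space \<mu>. \<forall>U. open U \<and> x \<in> U \<longrightarrow> 0 < measure \<mu> (U \<inter> space \<mu>)}"

definition lower_exponent :: "(real ^ 'd::finite) measure \<Rightarrow> real \<Rightarrow> ereal" where
  "lower_exponent \<mu> \<delta> =
     Sup {ereal s | s. \<exists>C>0. \<forall>r R. 0 < r \<and> r < R powr (1 + \<delta>) \<and> R powr (1 + \<delta>) \<le> R \<and> R < 1 \<longrightarrow>
        (INF x\<in>supp \<mu>. measure \<mu> (ball x R \<inter> space \<mu>) / measure \<mu> (ball x r \<inter> space \<mu>))
          \<ge> C * (R / r) powr s}"

definition dim_qL :: "(real ^ 'd::finite) measure \<Rightarrow> ereal" where
  "dim_qL \<mu> = Lim (at_right 0) (\<lambda>\<delta>. lower_exponent \<mu> \<delta>)"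

definition dim_L :: "(real ^ 'd::finite) measure \<Rightarrow> ereal" where
  "dim_L \<mu> = lower_exponent \<mu> 0"

end

theory Submission
  imports Defs "HOL-Real_Asymp.Real_Asymp"
begin

text \<open>
  Fix \<open>t < 1\<close>. From a word of length \<open>\<lfloor>m / \<delta>\<rfloor>\<close> follow a path of \<open>m\<close> edges towards the center of
  its cube: all labels on it are at least \<open>t\<close> with probability at least \<open>p ^ m\<close>, where \<open>p > 0\<close>
  depends on \<open>t\<close> only. The paths of distinct words are disjoint, hence independent, and there are at
  least \<open>2 ^ \<lfloor>m / \<delta>\<rfloor>\<close> of them. For small \<open>\<delta>\<close> this beats \<open>p ^ m\<close>, so almost surely for infinitely
  many \<open>m\<close> some central child carries at least the proportion \<open>t ^ m\<close> of the mass of its ancestor.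
  A ball of radius comparable to the child, centered at a point of the support in it, then carries at
  least the proportion \<open>t ^ m\<close> of the mass of a concentric ball of radius comparable to the ancestor.
  Letting \<open>t \<rightarrow> 1\<close> makes all the exponents vanish.
\<close>

section \<open>Geometry of dyadic cubes\<close>

lemma last_dyadic_endpoint:
  assumes "j + 1 = 2 ^ k"
  shows "(real j + 1) / 2 ^ k = 1"
  by (metis assms div_self of_nat_1 of_nat_add of_nat_numeral of_nat_power power_not_zero
      zero_neq_numeral)

lemma dyadic_interval_split:
  "dyadic_interval k j = dyadic_interval (Suc k) (2 * j) \<union> dyadic_interval (Suc k) (2 * j + 1)"
proof -
  \<comment> \<open>Parity: the left half is never the last interval of its generation, so it is
    always half-open; a closed last interval passes its right endpoint on to its right half.\<close>
  have no: "2 * j + 1 \<noteq> 2 ^ Suc k"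
    by (metis dvd_triv_left even_plus_one_iff power_Suc)
  have iff: "2 * j + 1 + 1 = 2 ^ Suc k \<longleftrightarrow> j + 1 = 2 ^ k"
    by auto
  have e: "real (2 * j) / 2 ^ Suc k = real j / 2 ^ k"
    "(real (2 * j) + 1) / 2 ^ Suc k = real (2 * j + 1) / 2 ^ Suc k"
    "(real (2 * j + 1) + 1) / 2 ^ Suc k = (real j + 1) / 2 ^ k"
    by (simp_all add: field_simps)
  have "real j / 2 ^ k \<le> real (2 * j + 1) / 2 ^ Suc k"
    "real (2 * j + 1) / 2 ^ Suc k \<le> (real j + 1) / 2 ^ k"
    by (simp_all add: field_simps)
  moreover note last_dyadic_endpoint[of j k]
  moreover have "(if P then {a..1} else {a..<c}) = {a..<b} \<union> (if P then {b..1} else {b..<c})"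
    if "a \<le> b" "b \<le> c" "P \<Longrightarrow> c = 1" for a b c :: real and P
    using that by auto
  ultimately show ?thesis
    unfolding dyadic_interval_def iff e if_not_P[OF no] by blast
qed

text \<open>Sandwiched between half-open and closed, the interval can be used without a case
  distinction on whether it is the last one.\<close>

lemma dyadic_interval_bounds:
  shows "{real j / 2 ^ k ..< (real j + 1) / 2 ^ k} \<subseteq> dyadic_interval k j"
    and "dyadic_interval k j \<subseteq> {real j / 2 ^ k .. (real j + 1) / 2 ^ k}"
  using last_dyadic_endpoint[of j k] by (auto simp: dyadic_interval_def)

lemma Inf_Sup_dyadic_interval:
  shows "Inf (dyadic_interval k j) = real j / 2 ^ k"
    and "Sup (dyadic_interval k j) = (real j + 1) / 2 ^ k"
proof -
  have less: "real j / 2 ^ k < (real j + 1) / 2 ^ k"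
    by (simp add: divide_strict_right_mono)
  show "Inf (dyadic_interval k j) = real j / 2 ^ k"
    and "Sup (dyadic_interval k j) = (real j + 1) / 2 ^ k"
    using less last_dyadic_endpoint[of j k]
    by (auto simp: dyadic_interval_def simp del: divide_eq_1_iff)
qed

text \<open>A single cube is addressed by its index vector \<open>z\<close>, so that center,
  projections and diameter can be computed coordinatewise.\<close>

definition dyadic_cube :: "nat \<Rightarrow> ('d \<Rightarrow> nat) \<Rightarrow> (real ^ 'd::finite) set" where
  "dyadic_cube k z = {x. \<forall>i. x $ i \<in> dyadic_interval k (z i)}"

lemma dyadic_cubes_eq: "dyadic_cubes k = {dyadic_cube k z | z. \<forall>i. z i < 2 ^ k}"
  by (simp add: dyadic_cubes_def dyadic_cube_def)

text \<open>Each side is halved by \<open>dyadic_interval_split\<close>, and the half containing the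
  coordinate of \<open>x\<close> is chosen.\<close>

lemma dyadic_cube_split:
  assumes "x \<in> dyadic_cube k z" and "\<And>i. z i < 2 ^ k"
  obtains C where "C \<in> dyadic_cubes (Suc k)" "C \<subseteq> dyadic_cube k z" "x \<in> C"
proof -
  define w where "w i = (if x $ i \<in> dyadic_interval (Suc k) (2 * z i) then 2 * z i else 2 * z i + 1)" for i
  have "w i < 2 ^ Suc k" for i
    using assms(2)[of i] by (auto simp: w_def)
  moreover have "x \<in> dyadic_cube (Suc k) w"
    using assms(1) by (auto simp: dyadic_cube_def w_def dyadic_interval_split[of k])
  moreover have "dyadic_cube (Suc k) w \<subseteq> dyadic_cube k z"
    using dyadic_interval_split[of k] by (fastforce simp: dyadic_cube_def w_def split: if_splits)
  ultimately show thesis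
    by (intro that[of "dyadic_cube (Suc k) w"]) (auto simp: dyadic_cubes_eq)
qed

lemma dyadic_cube_component:
  shows "(\<lambda>x. x $ i) ` dyadic_cube k z = dyadic_interval k (z i)"
proof
  show "dyadic_interval k (z i) \<subseteq> (\<lambda>x. x $ i) ` dyadic_cube k z"
  proof
    fix t assume t: "t \<in> dyadic_interval k (z i)"
    have ne: "real (z j) / 2 ^ k \<in> dyadic_interval k (z j)" for j
      using dyadic_interval_bounds(1)[where j = "z j" and k = k] by (auto simp: divide_strict_right_mono)
    show "t \<in> (\<lambda>x. x $ i) ` dyadic_cube k z"
      by (rule image_eqI[of _ _ "\<chi> j. if j = i then t else real (z j) / 2 ^ k"])
        (use t ne in \<open>auto simp: dyadic_cube_def\<close>)
  qed
qed (auto simp: dyadic_cube_def)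

lemma cube_center_component:
  shows "cube_center (dyadic_cube k z) $ i = (real (z i) + 1 / 2) / 2 ^ k"
  by (simp add: cube_center_def dyadic_cube_component Inf_Sup_dyadic_interval field_simps)

lemma cube_center_in:
  shows "cube_center (dyadic_cube k z) \<in> dyadic_cube k z"
proof -
  have "cube_center (dyadic_cube k z) $ i \<in> dyadic_interval k (z i)" for i
    by (intro subsetD[OF dyadic_interval_bounds(1)])
      (simp add: cube_center_component divide_strict_right_mono divide_right_mono)
  then show ?thesis
    by (simp add: dyadic_cube_def[of k z, THEN eqset_imp_iff])
qed

text \<open>Coordinates are 1-Lipschitz, and the radius is half the side length. As the ball is
  open, its points land in the half-open version of the cube.\<close>

lemma ball_cube_center:
  shows "ball (cube_center (dyadic_cube k z)) (1 / (2 * 2 ^ k)) \<subseteq> dyadic_cube k z"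
proof
  fix x assume x: "x \<in> ball (cube_center (dyadic_cube k z)) (1 / (2 * 2 ^ k))"
  have "x $ i \<in> {real (z i) / 2 ^ k ..< (real (z i) + 1) / 2 ^ k}" for i
  proof -
    have "\<bar>(cube_center (dyadic_cube k z) - x) $ i\<bar> < 1 / (2 * 2 ^ k)"
      using component_le_norm_cart[of "cube_center (dyadic_cube k z) - x" i] x
      by (simp add: dist_norm)
    then show ?thesis
      by (auto simp: cube_center_component field_simps abs_less_iff)
  qed
  then show "x \<in> dyadic_cube k z"
    using subsetD[OF dyadic_interval_bounds(1)] by (simp add: dyadic_cube_def)
qed

text \<open>The Euclidean norm is at most the sum of the absolute coordinates, each at most the side
  length. The crude factor d instead of sqrt d only changes constants.\<close>

lemma dist_closure_dyadic_cube:
  fixes z :: "'d::finite \<Rightarrow> nat"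
  assumes "x \<in> closure (dyadic_cube k z)" "y \<in> closure (dyadic_cube k z)"
  shows "dist x y \<le> real CARD('d) / 2 ^ k"
proof -
  define B :: "(real ^ 'd) set" where
    "B = cbox (\<chi> i. real (z i) / 2 ^ k) (\<chi> i. (real (z i) + 1) / 2 ^ k)"
  have "dyadic_cube k z \<subseteq> B"
    using dyadic_interval_bounds(2)
    by (auto simp: B_def dyadic_cube_def mem_box_cart) (meson atLeastAtMost_iff subsetD)+
  then have sub: "closure (dyadic_cube k z) \<subseteq> B"
    unfolding B_def by (rule closure_minimal) (rule closed_cbox)
  have "\<bar>(x - y) $ i\<bar> \<le> 1 / 2 ^ k" for i
  proof -
    have "x $ i \<in> {real (z i) / 2 ^ k .. (real (z i) + 1) / 2 ^ k}"
      "y $ i \<in> {real (z i) / 2 ^ k .. (real (z i) + 1) / 2 ^ k}"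
      using sub assms by (auto simp: B_def mem_box_cart)
    moreover have "(real (z i) + 1) / 2 ^ k = real (z i) / 2 ^ k + 1 / 2 ^ k"
      by (simp add: add_divide_distrib)
    ultimately show ?thesis
      by (auto simp: abs_le_iff)
  qed
  then have "(\<Sum>i\<in>UNIV. \<bar>(x - y) $ i\<bar>) \<le> (\<Sum>i\<in>(UNIV :: 'd set). 1 / 2 ^ k)"
    by (intro sum_mono)
  then show ?thesis
    using norm_le_l1_cart[of "x - y"] by (simp add: dist_norm)
qed

section \<open>Labelled cubes and descending paths towards a center\<close>

lemma labelled_cube:
  fixes Q :: "nat list \<Rightarrow> (real ^ 'd::finite) set"
  assumes "dyadic_labelling Q" "\<omega> \<in> words TYPE('d)"
  obtains z where "\<And>i. z i < 2 ^ length \<omega>" "Q \<omega> = dyadic_cube (length \<omega>) z"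
proof (cases \<omega> rule: rev_cases)
  case Nil
  have "Q [] = dyadic_cube 0 (\<lambda>_. 0)"
    using assms(1)
    by (auto simp: dyadic_labelling_def dyadic_cube_def dyadic_interval_def mem_box_cart)
  with Nil that show thesis
    by (metis length_0_conv less_numeral_extra(1) power_0)
next
  case (snoc v i)
  then have "Q (v @ [i]) \<in> (\<lambda>i. Q (v @ [i])) ` alphabet TYPE('d)" "v \<in> words TYPE('d)"
    using assms(2) by auto
  then have "Q \<omega> \<in> dyadic_cubes (length \<omega>)"
    using assms(1) snoc by (auto simp: dyadic_labelling_def bij_betw_def)
  with that show thesis
    by (auto simp: dyadic_cubes_eq)
qed

text \<open>The labels enumerate all dyadic subcubes of the next generation, and these cover the
  cube by \<open>dyadic_cube_split\<close>.\<close>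

lemma labelled_child:
  fixes Q :: "nat list \<Rightarrow> (real ^ 'd::finite) set"
  assumes Q: "dyadic_labelling Q" and w: "\<omega> \<in> words TYPE('d)"
  shows "(\<Union>i\<in>alphabet TYPE('d). Q (\<omega> @ [i])) = Q \<omega>"
proof -
  have img: "(\<lambda>i. Q (\<omega> @ [i])) ` alphabet TYPE('d) =
      {C \<in> dyadic_cubes (length \<omega> + 1). C \<subseteq> Q \<omega>}"
    using Q w by (auto simp: dyadic_labelling_def bij_betw_def)
  obtain z where z: "\<And>i. z i < 2 ^ length \<omega>" "Q \<omega> = dyadic_cube (length \<omega>) z"
    by (rule labelled_cube[OF Q w]) blast
  have "x \<in> \<Union>{C \<in> dyadic_cubes (length \<omega> + 1). C \<subseteq> Q \<omega>}" if x: "x \<in> Q \<omega>" for x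
    using dyadic_cube_split[of x "length \<omega>" z] x z
    by (metis (mono_tags, lifting) Suc_eq_plus1 Union_iff mem_Collect_eq)
  then show ?thesis
    unfolding img by auto
qed

text \<open>Closure commutes with finite unions. Closures matter because central children are
  defined by them.\<close>

lemma closure_labelled_child:
  fixes Q :: "nat list \<Rightarrow> (real ^ 'd::finite) set"
  assumes Q: "dyadic_labelling Q" and w: "\<omega> \<in> words TYPE('d)"
  shows "(\<Union>i\<in>alphabet TYPE('d). closure (Q (\<omega> @ [i]))) = closure (Q \<omega>)"
  unfolding labelled_child[OF assms, symmetric]
proof -
  have "closure (\<Union>i\<in>I. Q (\<omega> @ [i])) = (\<Union>i\<in>I. closure (Q (\<omega> @ [i])))" if "finite I" for I
    using that by (induction I) auto
  then show "(\<Union>i\<in>alphabet TYPE('d). closure (Q (\<omega> @ [i]))) = closure (\<Union>i\<in>alphabet TYPE('d). Q (\<omega> @ [i]))"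
    by simp
qed

text \<open>Induction on the depth: the closed children cover the closed cube, so one of them still
  contains the center. The probabilistic argument follows one such path per word.\<close>

lemma central_path_exists:
  fixes Q :: "nat list \<Rightarrow> (real ^ 'd::finite) set"
  assumes Q: "dyadic_labelling Q" and w: "\<omega> \<in> words TYPE('d)"
  shows "\<exists>v \<in> words TYPE('d). length v = m \<and> cube_center (Q \<omega>) \<in> closure (Q (\<omega> @ v))"
proof (induction m)
  case 0
  obtain z where z: "Q \<omega> = dyadic_cube (length \<omega>) z"
    by (rule labelled_cube[OF Q w]) blast
  have "cube_center (Q \<omega>) \<in> closure (Q \<omega>)"
    unfolding z using cube_center_in closure_subset by (rule rev_subsetD)
  then show ?case
    by (intro bexI[of _ "[]"]) auto
next
  case (Suc m)
  then obtain v where v: "v \<in> words TYPE('d)" "length v = m"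
    and c: "cube_center (Q \<omega>) \<in> closure (Q (\<omega> @ v))"
    by blast
  have "\<omega> @ v \<in> words TYPE('d)"
    using w v by auto
  from c obtain i where "i \<in> alphabet TYPE('d)" "cube_center (Q \<omega>) \<in> closure (Q (\<omega> @ v @ [i]))"
    unfolding closure_labelled_child[OF Q \<open>\<omega> @ v \<in> words TYPE('d)\<close>, symmetric] by auto
  with v show ?case
    by (intro bexI[of _ "v @ [i]"]) auto
qed

lemma labelled_subset:
  fixes Q :: "nat list \<Rightarrow> (real ^ 'd::finite) set"
  assumes Q: "dyadic_labelling Q" and "\<omega> \<in> words TYPE('d)" "v \<in> words TYPE('d)"
  shows "Q (\<omega> @ v) \<subseteq> Q \<omega>"
  using assms(3)
proof (induction v rule: rev_induct)
  case (snoc i v)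
  then have "Q ((\<omega> @ v) @ [i]) \<subseteq> Q (\<omega> @ v)"
    using labelled_child[OF Q, of "\<omega> @ v"] assms(2) by auto
  with snoc show ?case
    by auto
qed simp

lemma labelled_sets:
  fixes Q :: "nat list \<Rightarrow> (real ^ 'd::finite) set"
  assumes Q: "dyadic_labelling Q" and w: "\<omega> \<in> words TYPE('d)"
  shows "Q \<omega> \<in> sets cube_borel"
proof -
  obtain z where z: "Q \<omega> = dyadic_cube (length \<omega>) z"
    by (rule labelled_cube[OF Q w]) blast
  have [measurable]: "dyadic_interval k j \<in> sets borel" for k j
    by (simp add: dyadic_interval_def)
  have "Q \<omega> \<in> sets borel"
    unfolding z dyadic_cube_def by measurable
  moreover have "Q \<omega> \<subseteq> cbox 0 1"
    using labelled_subset[OF Q, of "[]" \<omega>] w Q by (auto simp: dyadic_labelling_def)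
  ultimately show ?thesis
    by (auto simp: cube_borel_def sets_restrict_space)
qed

section \<open>The uniform distribution on the simplex\<close>

lemma sets_simplex_chart:
  fixes n :: nat
  shows "{y \<in> space (\<Pi>\<^sub>M i\<in>{1..<n}. lborel).
      (\<forall>i\<in>{1..<n}. 0 \<le> y i) \<and> (\<Sum>i\<in>{1..<n}. y i) \<le> (1::real)} \<in> sets (\<Pi>\<^sub>M i\<in>{1..<n}. lborel)"
  by measurable

lemma measurable_simplex_chart:
  fixes n :: nat
  assumes "1 \<le> n"
  shows "(\<lambda>y. y(n := 1 - (\<Sum>i\<in>{1..<n}. y i)))
    \<in> (\<Pi>\<^sub>M i\<in>{1..<n}. lborel) \<rightarrow>\<^sub>M (\<Pi>\<^sub>M i\<in>{1..n}. (borel :: real measure))"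
proof -
  have "(\<lambda>y. y(n := 1 - (\<Sum>i\<in>{1..<n}. y i)))
    \<in> (\<Pi>\<^sub>M i\<in>{1..<n}. lborel) \<rightarrow>\<^sub>M (\<Pi>\<^sub>M i\<in>insert n {1..<n}. (borel :: real measure))"
  proof (rule measurable_PiM_single')
    fix i assume "i \<in> insert n {1..<n}"
    then show "(\<lambda>y. (y(n := 1 - (\<Sum>i\<in>{1..<n}. y i))) i) \<in> borel_measurable (\<Pi>\<^sub>M i\<in>{1..<n}. lborel)"
      by (cases "i = n") auto
  qed (auto simp: space_PiM PiE_def extensional_def)
  moreover have "insert n {1..<n} = {1..n}"
    using assms by auto
  ultimately show ?thesis by (simp only:)
qed

text \<open>By Fubini, as the zero set meets every line parallel to the \<open>i\<close>-th axis in at most one point.\<close>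
lemma AE_PiM_lborel_neq:
  fixes f :: "('i \<Rightarrow> real) \<Rightarrow> real"
  assumes "finite I" "i \<in> I" and f: "f \<in> borel_measurable (\<Pi>\<^sub>M i\<in>I. lborel)"
    and line: "\<And>x a b. f (x(i := a)) = 0 \<Longrightarrow> f (x(i := b)) = 0 \<Longrightarrow> a = b"
  shows "AE x in (\<Pi>\<^sub>M i\<in>I. lborel). f x \<noteq> 0"
proof -
  interpret product_sigma_finite "\<lambda>_. lborel :: real measure" ..
  define J where "J = I - {i}"
  have I: "I = insert i J" "finite J" "i \<notin> J"
    using assms by (auto simp: J_def)
  define N where "N = {x \<in> space (\<Pi>\<^sub>M i\<in>I. (lborel :: real measure)). f x = 0}"
  have N: "N \<in> sets (\<Pi>\<^sub>M i\<in>I. (lborel :: real measure))"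
    unfolding N_def using f by measurable
  have "emeasure (\<Pi>\<^sub>M i\<in>I. lborel) N = (\<integral>\<^sup>+ x. indicator N x \<partial>(\<Pi>\<^sub>M i\<in>I. lborel))"
    using N by simp
  also have "\<dots> = (\<integral>\<^sup>+ x. (\<integral>\<^sup>+ y. indicator N (x(i := y)) \<partial>lborel) \<partial>(\<Pi>\<^sub>M i\<in>J. lborel))"
    unfolding I(1) by (rule product_nn_integral_insert) (use I N in auto)
  also have "\<dots> = (\<integral>\<^sup>+ x. 0 \<partial>(\<Pi>\<^sub>M i\<in>J. (lborel :: real measure)))"
  proof (rule nn_integral_cong)
    fix x
    have "AE y in lborel. x(i := y) \<notin> N"
    proof (cases "\<exists>a. x(i := a) \<in> N")
      case True
      then obtain a where "f (x(i := a)) = 0" by (auto simp: N_def)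
      moreover have "AE y in lborel. y \<noteq> a" by (rule AE_lborel_singleton)
      ultimately show ?thesis by (auto elim!: eventually_mono simp: N_def dest: line)
    qed auto
    then show "(\<integral>\<^sup>+ y. indicator N (x(i := y)) \<partial>lborel) = (0 :: ennreal)"
      by (subst nn_integral_cong_AE[where v = "\<lambda>_. 0"]) (auto elim!: eventually_mono)
  qed
  finally have "emeasure (\<Pi>\<^sub>M i\<in>I. lborel) N = 0" by simp
  with N show ?thesis
    by (intro AE_I[of _ _ N]) (auto simp: N_def)
qed

text \<open>On the simplex all coordinates are nonnegative, and each of them vanishes only on a null
  set of the chart by \<open>AE_PiM_lborel_neq\<close>.\<close>

lemma AE_uniform_simplex_pos:
  assumes n: "2 \<le> n" and i: "i \<in> {1..n}"
  shows "AE x in uniform_simplex n. 0 < x i"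
proof -
  let ?L = "\<Pi>\<^sub>M i\<in>{1..<n}. (lborel :: real measure)"
  let ?S = "{y \<in> space ?L. (\<forall>i\<in>{1..<n}. 0 \<le> y i) \<and> (\<Sum>i\<in>{1..<n}. y i) \<le> 1}"
  have 1: "AE y in uniform_measure ?L ?S. 0 < (y(n := 1 - (\<Sum>i\<in>{1..<n}. y i))) i"
  proof (rule AE_uniform_measureI)
    show "?S \<in> sets ?L" by (rule sets_simplex_chart)
    have "AE y in ?L. (y(n := 1 - (\<Sum>i\<in>{1..<n}. y i))) i \<noteq> 0"
    proof (cases "i = n")
      case True
      \<comment> \<open>The last coordinate is strictly monotone in \<open>y 1\<close>, which is a
        chart coordinate because \<open>2 \<le> n\<close>.\<close>
      have "{1..<n} = insert 1 {2..<n}" using n by auto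
      then show ?thesis using True n
        by (intro AE_PiM_lborel_neq[of _ 1]) auto
    next
      case False
      then show ?thesis using i n
        by (intro AE_PiM_lborel_neq[of _ i]) auto
    qed
    then show "AE y in ?L. y \<in> ?S \<longrightarrow> 0 < (y(n := 1 - (\<Sum>i\<in>{1..<n}. y i))) i"
      using i by (auto elim!: eventually_mono simp: less_le)
  qed
  show ?thesis
    unfolding uniform_simplex_def
  proof (subst AE_distr_iff)
    show "(\<lambda>y. y(n := 1 - (\<Sum>i\<in>{1..<n}. y i))) \<in> uniform_measure ?L ?S \<rightarrow>\<^sub>M Pi\<^sub>M {1..n} (\<lambda>i. borel)"
      using measurable_simplex_chart[of n] n by simp
    show "{x \<in> space (Pi\<^sub>M {1..n} (\<lambda>i. borel)). 0 < x i} \<in> sets (Pi\<^sub>M {1..n} (\<lambda>i. borel :: real measure))"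
      using i by measurable
  qed (rule 1)
qed

text \<open>In the chart, the part of the simplex near the \<open>i\<close>-th vertex contains a box
  of positive volume.\<close>

lemma uniform_simplex_ge_pos:
  assumes n: "1 \<le> n" and i: "i \<in> {1..n}" and t: "0 < t" "t < 1"
  shows "0 < emeasure (uniform_simplex n) {x \<in> space (uniform_simplex n). t \<le> x i}"
proof -
  interpret product_sigma_finite "\<lambda>_. lborel :: real measure" ..
  let ?L = "\<Pi>\<^sub>M i\<in>{1..<n}. (lborel :: real measure)"
  let ?\<phi> = "\<lambda>y :: nat \<Rightarrow> real. y(n := 1 - (\<Sum>i\<in>{1..<n}. y i))"
  let ?S = "{y \<in> space ?L. (\<forall>i\<in>{1..<n}. 0 \<le> y i) \<and> (\<Sum>i\<in>{1..<n}. y i) \<le> 1}"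
  let ?U = "{x \<in> space (\<Pi>\<^sub>M i\<in>{1..n}. (borel :: real measure)). t \<le> x i}"
  let ?V = "?\<phi> -` ?U \<inter> space ?L"
  \<comment> \<open>\<open>l\<close> is the lowest corner of the box: the entry \<open>t\<close> in
    direction \<open>i\<close>, or the origin of the chart if \<open>i = n\<close>, where the last
    coordinate is \<open>1\<close>. The \<open>n - 1\<close> sides of length \<open>\<eta>\<close>
    add up to at most \<open>1 - t\<close>, which keeps the sum at most \<open>1\<close>, and for
    \<open>i = n\<close> the last coordinate at least \<open>t\<close>.\<close>
  define \<eta> where "\<eta> = (1 - t) / real n"
  define l where "l j = (if j = i then t else 0)" for j
  let ?B = "\<Pi>\<^sub>E j\<in>{1..<n}. {l j .. l j + \<eta>}"
  have \<eta>: "0 < \<eta>" using t n by (simp add: \<eta>_def)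
  have meas: "?\<phi> \<in> ?L \<rightarrow>\<^sub>M (\<Pi>\<^sub>M i\<in>{1..n}. borel)"
    using measurable_simplex_chart n by blast
  have U: "?U \<in> sets (\<Pi>\<^sub>M i\<in>{1..n}. (borel :: real measure))"
    using i by measurable
  have V: "?V \<in> sets ?L"
    using meas U by (rule measurable_sets)
  have "?B \<subseteq> ?S \<inter> ?V"
  proof
    fix y assume y: "y \<in> ?B"
    have sp: "y \<in> space ?L"
      using y by (auto simp: space_PiM PiE_def extensional_def)
    have yj: "l j \<le> y j" "y j \<le> l j + \<eta>" if "j \<in> {1..<n}" for j
      using y that by (auto simp: PiE_def Pi_def)
    have l0: "0 \<le> l j" for j using t by (simp add: l_def)
    have "(\<Sum>j\<in>{1..<n}. y j) \<le> (\<Sum>j\<in>{1..<n}. l j + \<eta>)"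
      by (intro sum_mono yj)
    also have "\<dots> = (if i < n then t else 0) + (real n - 1) * \<eta>"
      using i n by (auto simp: sum.distrib l_def of_nat_diff)
    finally have s1: "(\<Sum>j\<in>{1..<n}. y j) \<le> (if i < n then t else 0) + (real n - 1) * \<eta>" .
    have s2: "(real n - 1) * \<eta> \<le> 1 - t"
      using n t by (simp add: \<eta>_def field_simps)
    have "(\<Sum>j\<in>{1..<n}. y j) \<le> 1" and tn: "i = n \<Longrightarrow> t \<le> 1 - (\<Sum>j\<in>{1..<n}. y j)"
      using s1 s2 t by (auto split: if_splits)
    then have "y \<in> ?S"
      using sp order_trans[OF l0 yj(1)] by auto
    moreover have "t \<le> ?\<phi> y i"
      using tn yj(1)[of i] i by (cases "i = n") (auto simp: l_def)
    ultimately show "y \<in> ?S \<inter> ?V"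
      using sp measurable_space[OF meas sp] by auto
  qed
  then have "emeasure ?L ?B \<le> emeasure ?L (?S \<inter> ?V)"
    using V sets_simplex_chart[of n] by (intro emeasure_mono) auto
  moreover have "0 < emeasure ?L ?B"
    using \<eta> by (subst emeasure_PiM) (auto simp: zero_less_iff_neq_zero)
  ultimately have pos: "0 < emeasure ?L (?S \<inter> ?V)" by (rule less_le_trans[rotated])
  \<comment> \<open>The quotient below would be zero if the chart simplex had infinite volume; it
    lies in the unit box.\<close>
  have "y j \<le> 1" if y: "y \<in> ?S" and j: "j \<in> {1..<n}" for y j
    using member_le_sum[of j "{1..<n}" y] y j by auto
  then have "?S \<subseteq> (\<Pi>\<^sub>E j\<in>{1..<n}. {0..1})"
    by (auto simp: space_PiM PiE_def)
  then have "emeasure ?L ?S \<le> emeasure ?L (\<Pi>\<^sub>E j\<in>{1..<n}. {0..1})"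
    by (intro emeasure_mono) auto
  also have "\<dots> = 1"
    by (subst emeasure_PiM) auto
  finally have fin: "emeasure ?L ?S \<noteq> \<infinity>" by (auto simp: top_unique)
  have "emeasure (uniform_simplex n) {x \<in> space (uniform_simplex n). t \<le> x i}
      = emeasure (uniform_measure ?L ?S) ?V"
  proof -
    have "?\<phi> \<in> uniform_measure ?L ?S \<rightarrow>\<^sub>M (\<Pi>\<^sub>M i\<in>{1..n}. borel)"
      using meas by (simp only: measurable_cong_sets[OF sets_uniform_measure refl])
    from emeasure_distr[OF this U] show ?thesis
      by (simp only: uniform_simplex_def space_distr space_uniform_measure)
  qed
  also have "\<dots> = emeasure ?L (?S \<inter> ?V) / emeasure ?L ?S"
    using V sets_simplex_chart[of n] by (intro emeasure_uniform_measure) auto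
  also have "\<dots> > 0"
    using pos fin by (simp only: ennreal_zero_less_divide less_top infinity_ennreal_def simp_thms)
  finally show ?thesis .
qed

section \<open>Independent trials\<close>

text \<open>Within a block all trials succeed with probability at least \<open>p ^ m\<close>;
  disjoint blocks are independent, so their failure probabilities multiply. In the application
  \<open>K j\<close> consists of nodes on the path from the word \<open>j\<close>.\<close>

lemma (in prob_space) prob_all_blocks_fail_le:
  assumes indep: "indep_vars (\<lambda>_. N) X W"
    and J: "finite J" and K: "\<And>j. j \<in> J \<Longrightarrow> K j \<subseteq> W" "\<And>j. j \<in> J \<Longrightarrow> finite (K j)"
      "\<And>j. j \<in> J \<Longrightarrow> card (K j) \<le> m" and disj: "disjoint_family_on K J"
    and A: "\<And>j w. j \<in> J \<Longrightarrow> w \<in> K j \<Longrightarrow> A j w \<in> sets N"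
    and p: "0 \<le> p" "p \<le> 1"
      "\<And>j w. j \<in> J \<Longrightarrow> w \<in> K j \<Longrightarrow> p \<le> prob (X w -` A j w \<inter> space M)"
  shows "prob {x \<in> space M. \<forall>j\<in>J. \<exists>w\<in>K j. X w x \<notin> A j w} \<le> (1 - p ^ m) ^ card J"
proof (cases "J = {}")
  case False
  \<comment> \<open>The trials of a block are bundled into one variable with values in a product
    space; \<open>F j\<close> is the complement of the box of success.\<close>
  let ?Y = "\<lambda>j x. restrict (\<lambda>w. X w x) (K j)"
  define F where "F j = space (PiM (K j) (\<lambda>_. N)) - PiE (K j) (A j)" for j
  have X: "X w \<in> M \<rightarrow>\<^sub>M N" if "w \<in> W" for w
    using indep that by (simp add: indep_vars_def2)
  have iY: "indep_vars (\<lambda>j. PiM (K j) (\<lambda>_. N)) ?Y J"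
    using indep K(1) disj by (rule indep_vars_restrict)
  have F: "F j \<in> sets (PiM (K j) (\<lambda>_. N))" if "j \<in> J" for j
    unfolding F_def using K(2)[OF that] A[OF that] by auto
  have Y: "?Y j \<in> M \<rightarrow>\<^sub>M PiM (K j) (\<lambda>_. N)" if "j \<in> J" for j
    using iY that by (simp add: indep_vars_def2)
  have fail: "?Y j -` F j \<inter> space M = space M - {x \<in> space M. \<forall>w\<in>K j. X w x \<in> A j w}" if "j \<in> J" for j
    using measurable_space[OF Y[OF that]] by (auto simp: F_def PiE_def Pi_def)
  have "{x \<in> space M. \<forall>j\<in>J. \<exists>w\<in>K j. X w x \<notin> A j w} = (\<Inter>j\<in>J. ?Y j -` F j \<inter> space M)"
    using False by (auto simp: fail)
  also have "prob \<dots> = (\<Prod>j\<in>J. prob (?Y j -` F j \<inter> space M))"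
    using iY False J by (rule indep_varsD) (use F in auto)
  also have "\<dots> \<le> (\<Prod>j\<in>J. 1 - p ^ m)"
  proof (rule prod_mono, rule conjI)
    fix j assume j: "j \<in> J"
    have "p ^ m \<le> prob {x \<in> space M. \<forall>w\<in>K j. X w x \<in> A j w}"
    proof (cases "K j = {}")
      case True
      then show ?thesis using p by (simp add: prob_space power_le_one)
    next
      case ne: False
      have "p ^ m \<le> p ^ card (K j)"
        using p K(3)[OF j] by (intro power_decreasing) auto
      also have "\<dots> = (\<Prod>w\<in>K j. p)" by simp
      also have "\<dots> \<le> (\<Prod>w\<in>K j. prob (X w -` A j w \<inter> space M))"
        using p j by (intro prod_mono) auto
      also have "\<dots> = prob (\<Inter>w\<in>K j. X w -` A j w \<inter> space M)"
        by (rule indep_varsD[OF indep ne K(2)[OF j] K(1)[OF j] A[OF j], symmetric])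
      also have "(\<Inter>w\<in>K j. X w -` A j w \<inter> space M) = {x \<in> space M. \<forall>w\<in>K j. X w x \<in> A j w}"
        using ne by auto
      finally show ?thesis .
    qed
    moreover have "{x \<in> space M. \<forall>w\<in>K j. X w x \<in> A j w} \<in> events"
    proof (rule sets.sets_Collect_finite_All)
      fix w assume "w \<in> K j"
      then show "{x \<in> space M. X w x \<in> A j w} \<in> events"
        using measurable_sets[OF X A[OF j], of w w] K(1)[OF j] by (auto simp: vimage_def Int_def conj_commute)
    qed (rule K(2)[OF j])
    ultimately show "prob (?Y j -` F j \<inter> space M) \<le> 1 - p ^ m"
      unfolding fail[OF j] by (simp add: prob_compl)
  qed simp
  finally show ?thesis by simp
qed simp

text \<open>The event that \<open>B\<close> holds from \<open>m0\<close> on lies in every later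
  event, so its probability is at most the limit. This takes the place of Borel-Cantelli.\<close>

lemma (in prob_space) AE_frequently_if_prob_tendsto_0:
  assumes B: "\<And>m. {x \<in> space M. B m x} \<in> events"
    and lim: "(\<lambda>m. prob {x \<in> space M. B m x}) \<longlonglongrightarrow> 0"
  shows "AE x in M. \<exists>\<^sub>F m in sequentially. \<not> B m x"
proof -
  have "AE x in M. \<exists>m\<ge>m0. \<not> B m x" for m0
  proof -
    let ?E = "{x \<in> space M. \<forall>m\<in>{m0..}. B m x}"
    have E: "?E \<in> events"
      by (intro sets.sets_Collect_countable_Ball B)
    have "prob ?E \<le> prob {x \<in> space M. B m x}" if "m0 \<le> m" for m
      using that by (intro finite_measure_mono B) auto
    then have "prob ?E \<le> 0"
      by (intro tendsto_lowerbound[OF lim]) (auto simp: eventually_sequentially)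
    then have "prob ?E = 0"
      by (simp add: measure_le_0_iff)
    with E show ?thesis
      by (intro AE_I[of _ _ ?E]) (auto simp: emeasure_eq_measure)
  qed
  then show ?thesis
    by (simp add: frequently_sequentially AE_all_countable)
qed

text \<open>By \<open>1 - x \<le> exp (- x)\<close> the power is at most
  \<open>exp (- (p ^ m * N m))\<close>, and
  \<open>p ^ m * N m \<ge> (p * 2 ^ k) ^ m \<ge> 2 ^ m\<close>.\<close>

lemma tendsto_one_minus_power_dyadic_0:
  fixes p :: real
  assumes "0 < p" "p \<le> 1" "2 \<le> p * 2 ^ k" and N: "\<And>m. 2 ^ (k * m) \<le> N m"
  shows "(\<lambda>m. (1 - p ^ m) ^ N m) \<longlonglongrightarrow> 0"
proof (rule tendsto_sandwich[OF _ _ tendsto_const])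
  show "\<forall>\<^sub>F m in sequentially. 0 \<le> (1 - p ^ m) ^ N m"
    using assms by (intro always_eventually allI zero_le_power) (simp add: power_le_one)
  have "(1 - p ^ m) ^ N m \<le> exp (- (2 ^ m))" for m
  proof -
    have "(1 - p ^ m) ^ N m \<le> exp (- (p ^ m)) ^ N m"
      using assms exp_ge_add_one_self[of "- (p ^ m)"] by (intro power_mono) (auto simp: power_le_one)
    also have "\<dots> = exp (- (p ^ m * real (N m)))"
      by (simp flip: exp_of_nat_mult)
    also have "\<dots> \<le> exp (- (2 ^ m))"
    proof -
      have "2 ^ m \<le> (p * 2 ^ k) ^ m"
        using assms by (intro power_mono) auto
      then have "2 ^ m \<le> p ^ m * real (2 ^ (k * m))"
        by (simp add: power_mult_distrib power_mult)
      then have "2 ^ m \<le> p ^ m * real (N m)"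
        using assms N[of m] by (meson mult_left_mono of_nat_le_iff order_trans zero_le_power less_imp_le)
      then show ?thesis by simp
    qed
    finally show ?thesis .
  qed
  then show "\<forall>\<^sub>F m in sequentially. (1 - p ^ m) ^ N m \<le> exp (- (2 ^ m))" by simp
  show "(\<lambda>m. exp (- (2 ^ m)) :: real) \<longlonglongrightarrow> 0"
    by real_asymp
qed

section \<open>Heavy central children\<close>

text \<open>For \<open>t > 0\<close> and a dyadic labelling this says
  \<open>h_central Q m \<delta> \<nu> \<le> 1 / t ^ m\<close>, without division. The claims on
  \<open>h_central\<close> and on the dimensions are both derived from it.\<close>

definition heavy_central ::
    "(nat list \<Rightarrow> (real ^ 'd::finite) set) \<Rightarrow> real \<Rightarrow> real \<Rightarrow> nat \<Rightarrow> (real ^ 'd) measure \<Rightarrow> bool" where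
  "heavy_central Q t \<delta> m \<nu> \<longleftrightarrow>
     (\<exists>\<omega> \<in> {\<omega> \<in> words TYPE('d). length \<omega> = nat \<lfloor>real m / \<delta>\<rfloor>}. \<exists>\<omega>' \<in> central_children Q m \<omega>.
        0 < measure \<nu> (Q \<omega>') \<and> t ^ m * measure \<nu> (Q \<omega>) \<le> measure \<nu> (Q \<omega>'))"

lemma finite_words_length: "finite {\<omega> \<in> words TYPE('d::finite). length \<omega> = l}"
  using finite_lists_length_eq[of "alphabet TYPE('d)" l] by (simp add: lists_eq_set)

lemma card_words_length: "card {\<omega> \<in> words TYPE('d::finite). length \<omega> = l} = (2 ^ CARD('d)) ^ l"
  using card_lists_length_eq[of "alphabet TYPE('d)" l] by (simp add: lists_eq_set)

lemma prod_lessThan_add: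
  fixes f :: "nat \<Rightarrow> 'a::comm_monoid_mult"
  shows "(\<Prod>j<a + b. f j) = (\<Prod>j<a. f j) * (\<Prod>j<b. f (a + j))"
  by (induction b) (auto simp: mult.assoc)

text \<open>All label vectors have the same law, and by \<open>uniform_simplex_ge_pos\<close> each
  of the finitely many coordinates reaches \<open>t\<close> with positive probability; the minimum
  serves all nodes.\<close>

lemma cascade_label_ge:
  fixes Q :: "nat list \<Rightarrow> (real ^ 'd::finite) set"
  assumes "random_cascade M X Q \<mu>" and t: "0 < t" "t < 1"
  obtains p where "0 < p" "p \<le> 1"
    "\<And>w i. w \<in> words TYPE('d) \<Longrightarrow> i \<in> alphabet TYPE('d) \<Longrightarrow>
       p \<le> measure M (X w -` {x \<in> space (\<Pi>\<^sub>M i\<in>alphabet TYPE('d). borel). t \<le> x i} \<inter> space M)"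
proof -
  let ?N = "\<Pi>\<^sub>M i\<in>alphabet TYPE('d). (borel :: real measure)" and ?n = "2 ^ CARD('d) :: nat"
  interpret prob_space M
    using assms(1) by (simp add: random_cascade_def)
  have X: "X w \<in> M \<rightarrow>\<^sub>M ?N" and dX: "distr M ?N (X w) = uniform_simplex ?n"
    if "w \<in> words TYPE('d)" for w
    using assms(1) that by (auto simp: random_cascade_def indep_vars_def2)
  define q where "q i = measure (uniform_simplex ?n) {x \<in> space (uniform_simplex ?n). t \<le> x i}" for i
  have U: "{x \<in> space ?N. t \<le> x i} \<in> sets ?N" if "i \<in> alphabet TYPE('d)" for i
    using that by measurable
  have q: "q i = prob (X w -` {x \<in> space ?N. t \<le> x i} \<inter> space M)"
    if "w \<in> words TYPE('d)" "i \<in> alphabet TYPE('d)" for w i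
    unfolding q_def dX[OF that(1), symmetric] space_distr
    by (rule measure_distr[OF X[OF that(1)] U[OF that(2)]])
  have q_pos: "0 < q i" if i: "i \<in> alphabet TYPE('d)" for i
  proof -
    interpret U: prob_space "uniform_simplex ?n"
      using prob_space_distr[OF X[of "[]"]] dX[of "[]"] by simp
    show ?thesis
      using uniform_simplex_ge_pos[OF _ i t] by (simp add: q_def U.emeasure_eq_measure)
  qed
  have q_le: "q i \<le> 1" if "i \<in> alphabet TYPE('d)" for i
    using q[OF _ that, of "[]"] by simp
  show thesis
  proof (rule that[of "Min (q ` alphabet TYPE('d))"])
    show "0 < Min (q ` alphabet TYPE('d))"
      using q_pos by (subst Min_gr_iff) auto
    show "Min (q ` alphabet TYPE('d)) \<le> 1"
      using q_le[of 1] by (intro order_trans[OF Min_le]) auto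
    fix w i assume wi: "w \<in> words TYPE('d)" "i \<in> alphabet TYPE('d)"
    show "Min (q ` alphabet TYPE('d)) \<le> prob (X w -` {x \<in> space ?N. t \<le> x i} \<inter> space M)"
      unfolding q[OF wi, symmetric] using wi by (intro Min_le) auto
  qed
qed

text \<open>There are only countably many words, so the null events of
  \<open>AE_uniform_simplex_pos\<close> can be united. With the mass formula of
  \<open>random_cascade\<close> all cube masses become positive.\<close>

lemma cascade_label_pos:
  fixes Q :: "nat list \<Rightarrow> (real ^ 'd::finite) set"
  assumes "random_cascade M X Q \<mu>"
  shows "AE x in M. \<forall>w \<in> words TYPE('d). \<forall>i \<in> alphabet TYPE('d). 0 < X w x i"
proof -
  let ?N = "\<Pi>\<^sub>M i\<in>alphabet TYPE('d). (borel :: real measure)" and ?n = "2 ^ CARD('d) :: nat"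
  interpret prob_space M
    using assms by (simp add: random_cascade_def)
  have n: "2 \<le> ?n"
    by (simp add: self_le_power)
  have "AE x in M. 0 < X w x i" if w: "w \<in> words TYPE('d)" and i: "i \<in> alphabet TYPE('d)" for w i
  proof -
    have X: "X w \<in> M \<rightarrow>\<^sub>M ?N" and dX: "distr M ?N (X w) = uniform_simplex ?n"
      using assms w by (auto simp: random_cascade_def indep_vars_def2)
    have "{x \<in> space ?N. 0 < x i} \<in> sets ?N"
      using i by measurable
    with AE_uniform_simplex_pos[OF n i] show ?thesis
      unfolding dX[symmetric] by (simp add: AE_distr_iff[OF X])
  qed
  then show ?thesis
    by (intro AE_ball_countable') (auto intro: countableI_type)
qed

text \<open>The chosen paths from the words of one level are disjoint blocks of independent label
  vectors, so \<open>prob_all_blocks_fail_le\<close> applies. The threshold is \<open>1 / k\<close>,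
  with \<open>k\<close> determined by the label bound \<open>p\<close>.\<close>

lemma AE_frequently_heavy_central:
  fixes Q :: "nat list \<Rightarrow> (real ^ 'd::finite) set"
  assumes Q: "dyadic_labelling Q" and cascade: "random_cascade M X Q \<mu>" and t: "0 < t" "t < 1"
  shows "\<exists>\<delta>0>0. \<forall>\<delta>. 0 < \<delta> \<and> \<delta> \<le> \<delta>0 \<longrightarrow>
    (AE x in M. \<exists>\<^sub>F m in sequentially. heavy_central Q t \<delta> m (\<mu> x))"
proof -
  let ?W = "words TYPE('d)" and ?N = "\<Pi>\<^sub>M i\<in>alphabet TYPE('d). (borel :: real measure)"
  interpret prob_space M
    using cascade by (simp add: random_cascade_def)
  have indep: "indep_vars (\<lambda>_. ?N) X ?W"
    using cascade by (simp add: random_cascade_def)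
  then have X: "X w \<in> M \<rightarrow>\<^sub>M ?N" if "w \<in> ?W" for w
    using that by (simp add: indep_vars_def2)
  obtain p where p: "0 < p" "p \<le> 1" "\<And>w i. w \<in> ?W \<Longrightarrow> i \<in> alphabet TYPE('d) \<Longrightarrow>
      p \<le> prob (X w -` {x \<in> space ?N. t \<le> x i} \<inter> space M)"
    by (rule cascade_label_ge[OF cascade t]) blast
  \<comment> \<open>This gives \<open>2 \<le> p * 2 ^ k\<close>, so that \<open>2 ^ (k * m)\<close>
    words outweigh the success probability \<open>p ^ m\<close> of one path.\<close>
  obtain k where k: "2 / p < 2 ^ k"
    using real_arch_pow[of 2 "2 / p"] by auto
  then have k0: "0 < k"
    using p by (intro gr0I) (auto simp: field_simps)
  have "AE x in M. \<exists>\<^sub>F m in sequentially. heavy_central Q t \<delta> m (\<mu> x)"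
    if \<delta>: "0 < \<delta>" "\<delta> \<le> 1 / real k" for \<delta>
  proof -
    define l where "l m = nat \<lfloor>real m / \<delta>\<rfloor>" for m
    \<comment> \<open>Here \<open>\<delta> \<le> 1 / k\<close> enters: the level is deep enough to
      have \<open>2 ^ (k * m)\<close> words.\<close>
    have l: "k * m \<le> l m" for m
    proof -
      have "real (k * m) \<le> real m / \<delta>"
        using \<delta> k0 mult_left_mono[of "\<delta> * real k" 1 "real m"] by (simp add: field_simps)
      then show ?thesis
        unfolding l_def by (simp add: le_nat_floor)
    qed
    define J where "J m = {\<omega> \<in> ?W. length \<omega> = l m}" for m
    have "\<exists>v. \<forall>\<omega>\<in>?W. v \<omega> \<in> ?W \<and> length (v \<omega>) = m \<and> cube_center (Q \<omega>) \<in> closure (Q (\<omega> @ v \<omega>))" for m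
      using central_path_exists[OF Q, of _ m] by metis
    then obtain v where v: "\<omega> \<in> ?W \<Longrightarrow> v m \<omega> \<in> ?W"
      "\<omega> \<in> ?W \<Longrightarrow> length (v m \<omega>) = m"
      "\<omega> \<in> ?W \<Longrightarrow> cube_center (Q \<omega>) \<in> closure (Q (\<omega> @ v m \<omega>))" for m \<omega>
      by metis
    \<comment> \<open>\<open>K m \<omega>\<close> holds the starting nodes of the \<open>m\<close>
      edges of the path, without its endpoint. In \<open>A\<close> the number
      \<open>length w - l m\<close> recovers the position of \<open>w\<close> on the path, hence the
      letter of the edge leaving it.\<close>
    define K where "K m \<omega> = (\<lambda>j. \<omega> @ take j (v m \<omega>)) ` {..<m}" for m \<omega>
    define A where "A m \<omega> w = {x \<in> space ?N. t \<le> x (v m \<omega> ! (length w - l m))}" for m \<omega> and w :: "nat list"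
    define B where "B m x \<longleftrightarrow> (\<forall>\<omega>\<in>J m. \<exists>w\<in>K m \<omega>. X w x \<notin> A m \<omega> w)" for m x
    have label: "v m \<omega> ! (length w - l m) \<in> alphabet TYPE('d)" if "\<omega> \<in> J m" "w \<in> K m \<omega>" for m \<omega> w
    proof -
      have "\<omega> \<in> ?W" using that by (simp add: J_def)
      moreover have "length w - l m < m"
        using that by (auto simp: J_def K_def)
      ultimately show ?thesis
        using v(1,2)[of \<omega> m] by (metis in_lists_conv_set nth_mem)
    qed
    have KW: "K m \<omega> \<subseteq> ?W" if "\<omega> \<in> J m" for m \<omega>
      using that v(1)[of \<omega> m] by (fastforce simp: J_def K_def lists_eq_set dest: in_set_takeD)
    have A: "A m \<omega> w \<in> sets ?N" if "\<omega> \<in> J m" "w \<in> K m \<omega>" for m \<omega> w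
      using label[OF that] unfolding A_def by measurable
    \<comment> \<open>The first \<open>l m\<close> letters of a node on a path recover the word
      where the path starts, so the blocks are disjoint.\<close>
    have "take (l m) w = \<omega>" if "\<omega> \<in> J m" "w \<in> K m \<omega>" for m \<omega> w
      using that by (auto simp: J_def K_def)
    then have disj: "disjoint_family_on (K m) (J m)" for m
      unfolding disjoint_family_on_def by (metis Int_emptyI)
    have finJ: "finite (J m)" for m
      unfolding J_def by (rule finite_words_length)
    have B_sets: "{x \<in> space M. B m x} \<in> events" for m
      unfolding B_def
    proof (intro sets.sets_Collect_finite_All sets.sets_Collect_finite_Ex finJ)
      fix \<omega> w assume w: "\<omega> \<in> J m" "w \<in> K m \<omega>"
      then have "X w -` (space ?N - A m \<omega> w) \<inter> space M \<in> events"
        using KW by (intro measurable_sets[OF X] sets.Diff A sets.top) auto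
      also have "X w -` (space ?N - A m \<omega> w) \<inter> space M = {x \<in> space M. X w x \<notin> A m \<omega> w}"
      proof -
        have "w \<in> ?W" using w KW by blast
        from measurable_space[OF X[OF this]] show ?thesis by auto
      qed
      finally show "{x \<in> space M. X w x \<notin> A m \<omega> w} \<in> events" .
    qed (simp add: K_def)
    have B_prob: "prob {x \<in> space M. B m x} \<le> (1 - p ^ m) ^ card (J m)" for m
      unfolding B_def
    proof (rule prob_all_blocks_fail_le[OF indep finJ KW _ _ disj A])
      show "card (K m \<omega>) \<le> m" for \<omega>
        unfolding K_def using card_image_le[of "{..<m}"] by simp
      show "p \<le> prob (X w -` A m \<omega> w \<inter> space M)" if "\<omega> \<in> J m" "w \<in> K m \<omega>" for \<omega> w
        unfolding A_def using that KW label[OF that] by (intro p(3)) auto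
    qed (use p in \<open>auto simp: K_def\<close>)
    have "2 ^ (k * m) \<le> card (J m)" for m
    proof -
      have "(2::nat) ^ (k * m) \<le> 2 ^ l m"
        using l by (intro power_increasing) auto
      also have "\<dots> \<le> (2 ^ CARD('d)) ^ l m"
        by (intro power_mono) (auto simp: self_le_power)
      finally show ?thesis
        unfolding J_def card_words_length .
    qed
    moreover have "2 \<le> p * 2 ^ k"
      using k p by (simp add: field_simps)
    ultimately have "(\<lambda>m. (1 - p ^ m) ^ card (J m)) \<longlonglongrightarrow> 0"
      using p by (intro tendsto_one_minus_power_dyadic_0[of p k]) auto
    then have "(\<lambda>m. prob {x \<in> space M. B m x}) \<longlonglongrightarrow> 0"
      by (rule tendsto_sandwich[OF _ _ tendsto_const, rotated 2]) (use B_prob in auto)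
    then have freq: "AE x in M. \<exists>\<^sub>F m in sequentially. \<not> B m x"
      by (rule AE_frequently_if_prob_tendsto_0[OF B_sets])
    have mass: "AE x in M. \<forall>\<omega>\<in>?W. measure (\<mu> x) (Q \<omega>) = (\<Prod>j<length \<omega>. X (take j \<omega>) x (\<omega> ! j))"
      using cascade by (simp add: random_cascade_def)
    show ?thesis
      using freq mass cascade_label_pos[OF cascade] AE_space
    proof eventually_elim
      case (elim x)
      show ?case
        using elim(1)
      proof (rule frequently_elim1)
        fix m assume "\<not> B m x"
        then obtain \<omega> where \<omega>: "\<omega> \<in> J m" and good: "\<And>w. w \<in> K m \<omega> \<Longrightarrow> X w x \<in> A m \<omega> w"
          by (auto simp: B_def)
        let ?v = "v m \<omega>"
        have \<omega>W: "\<omega> \<in> ?W" "length \<omega> = l m"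
          using \<omega> by (auto simp: J_def)
        note v = v[OF \<omega>W(1), of m]
        have \<omega>v: "\<omega> @ ?v \<in> ?W"
          using \<omega>W v by auto
        have pos: "0 < measure (\<mu> x) (Q \<omega>')" if "\<omega>' \<in> ?W" for \<omega>'
        proof -
          have "0 < X (take j \<omega>') x (\<omega>' ! j)" if "j < length \<omega>'" for j
            using that \<open>\<omega>' \<in> ?W\<close> elim(3) by (meson in_lists_conv_set in_set_takeD nth_mem)
          then have "0 < (\<Prod>j<length \<omega>'. X (take j \<omega>') x (\<omega>' ! j))"
            by (intro prod_pos) auto
          also have "\<dots> = measure (\<mu> x) (Q \<omega>')"
            using elim(2) that by metis
          finally show ?thesis .
        qed
        have "t \<le> X (\<omega> @ take j ?v) x (?v ! j)" if "j < m" for j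
          using good[of "\<omega> @ take j ?v"] that \<omega>W v(2) by (auto simp: K_def A_def)
        then have "t ^ m \<le> (\<Prod>j<m. X (\<omega> @ take j ?v) x (?v ! j))"
          using prod_mono[of "{..<m}" "\<lambda>_. t" "\<lambda>j. X (\<omega> @ take j ?v) x (?v ! j)"] t by simp
        \<comment> \<open>The product of labels down to the child splits at the length of
          \<open>\<omega>\<close>.\<close>
        moreover have "measure (\<mu> x) (Q (\<omega> @ ?v)) =
            measure (\<mu> x) (Q \<omega>) * (\<Prod>j<m. X (\<omega> @ take j ?v) x (?v ! j))"
          using elim(2) \<omega>v \<omega>W v(2) by (simp add: prod_lessThan_add nth_append)
        ultimately have "t ^ m * measure (\<mu> x) (Q \<omega>) \<le> measure (\<mu> x) (Q (\<omega> @ ?v))"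
          by (simp add: mult.commute[of "t ^ m"] mult_left_mono)
        moreover have "\<omega> @ ?v \<in> central_children Q m \<omega>"
          using v by (auto simp: central_children_def)
        ultimately show "heavy_central Q t \<delta> m (\<mu> x)"
          using \<omega> pos[OF \<omega>v] unfolding heavy_central_def J_def l_def by blast
      qed
    qed
  qed
  then show ?thesis
    using k0 by (intro exI[of _ "1 / real k"]) auto
qed

section \<open>Lower exponents and central ratios\<close>

lemma space_cube_measure:
  fixes \<nu> :: "(real ^ 'd::finite) measure"
  assumes "sets \<nu> = sets cube_borel"
  shows "space \<nu> = cbox 0 1"
  using sets_eq_imp_space_eq[OF assms] by (simp add: cube_borel_def space_restrict_space)

lemma open_Int_cube_sets:
  fixes \<nu> :: "(real ^ 'd::finite) measure"
  assumes "sets \<nu> = sets cube_borel" "open U"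
  shows "U \<inter> space \<nu> \<in> sets \<nu>"
  using assms by (auto simp: space_cube_measure cube_borel_def sets_restrict_space)

text \<open>Outside the support the space is covered by countably many null basic open sets, so no
  set of positive mass fits there. This supplies the centers of balls, as the center of a cube need
  not lie in the support.\<close>

lemma supp_meets_non_null:
  fixes \<nu> :: "(real ^ 'd::finite) measure"
  assumes "finite_measure \<nu>" and sets: "sets \<nu> = sets cube_borel" and A: "A \<in> sets \<nu>" "0 < measure \<nu> A"
  obtains x where "x \<in> supp \<nu>" "x \<in> A"
proof -
  interpret finite_measure \<nu> by fact
  obtain \<B> :: "(real ^ 'd) set set" where \<B>: "countable \<B>" "topological_basis \<B>"
    using ex_countable_basis by blast
  define \<N> where "\<N> = {U \<in> \<B>. measure \<nu> (U \<inter> space \<nu>) = 0}"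
  have "(\<Union>U\<in>\<N>. U \<inter> space \<nu>) \<in> null_sets \<nu>"
  proof (rule null_sets_UN')
    show "countable \<N>"
      unfolding \<N>_def using \<B>(1) by (rule countable_subset[rotated]) auto
    fix U assume "U \<in> \<N>"
    then have "open U" "measure \<nu> (U \<inter> space \<nu>) = 0"
      using topological_basis_open[OF \<B>(2)] by (auto simp: \<N>_def)
    then show "U \<inter> space \<nu> \<in> null_sets \<nu>"
      using open_Int_cube_sets[OF sets] by (auto simp: null_sets_def emeasure_eq_measure)
  qed
  moreover have "A \<notin> null_sets \<nu>"
    using A by (auto simp: null_sets_def emeasure_eq_measure)
  ultimately obtain x where x: "x \<in> A" "x \<notin> (\<Union>U\<in>\<N>. U \<inter> space \<nu>)"
    using null_sets_subset[OF _ A(1)] by blast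
  have xs: "x \<in> space \<nu>"
    using x(1) A(1) sets.sets_into_space by blast
  have "0 < measure \<nu> (U \<inter> space \<nu>)" if U: "open U" "x \<in> U" for U
  proof -
    obtain V where V: "V \<in> \<B>" "x \<in> V" "V \<subseteq> U"
      using topological_basisE[OF \<B>(2) U] by blast
    then have "measure \<nu> (V \<inter> space \<nu>) \<noteq> 0"
      using x(2) xs by (auto simp: \<N>_def)
    moreover have "measure \<nu> (V \<inter> space \<nu>) \<le> measure \<nu> (U \<inter> space \<nu>)"
      using V U open_Int_cube_sets[OF sets] by (intro finite_measure_mono) auto
    ultimately show ?thesis
      using measure_nonneg[of \<nu> "V \<inter> space \<nu>"] by linarith
  qed
  with xs have "x \<in> supp \<nu>"
    by (simp add: supp_def)
  with x(1) that show thesis by blast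
qed

text \<open>Since \<open>R < 1\<close>, a larger \<open>\<delta>\<close> admits fewer pairs of radii
  and thus weakens the condition on \<open>s\<close>.\<close>

lemma lower_exponent_mono:
  assumes "0 \<le> \<delta>" "\<delta> \<le> \<delta>'"
  shows "lower_exponent \<nu> \<delta> \<le> lower_exponent \<nu> \<delta>'"
proof -
  have "r < R powr (1 + \<delta>) \<and> R powr (1 + \<delta>) \<le> R"
    if "0 < r" "r < R powr (1 + \<delta>')" "R powr (1 + \<delta>') \<le> R" "R < 1" for r R :: real
  proof -
    have "0 < R" using that by linarith
    then have "R powr (1 + \<delta>') \<le> R powr (1 + \<delta>)" "R powr (1 + \<delta>) \<le> R powr 1"
      using assms that by (intro powr_mono'; simp)+
    with \<open>0 < R\<close> that show ?thesis by simp
  qed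
  then show ?thesis
    unfolding lower_exponent_def by (intro Sup_subset_mono) blast
qed

text \<open>The exponent \<open>0\<close> is admissible with \<open>C = 1\<close>, as masses of
  concentric balls increase with the radius.\<close>

lemma lower_exponent_nonneg:
  fixes \<nu> :: "(real ^ 'd::finite) measure"
  assumes sets: "sets \<nu> = sets cube_borel" and "prob_space \<nu>"
  shows "0 \<le> lower_exponent \<nu> \<delta>"
proof -
  interpret prob_space \<nu> by fact
  \<comment> \<open>Bounding a real infimum from below requires a nonempty support.\<close>
  obtain x0 where x0: "x0 \<in> supp \<nu>"
    by (rule supp_meets_non_null[OF finite_measure_axioms sets, of "space \<nu>"]) (auto simp: prob_space)
  have "1 * (R / r) powr 0 \<le>
      (INF x\<in>supp \<nu>. measure \<nu> (ball x R \<inter> space \<nu>) / measure \<nu> (ball x r \<inter> space \<nu>))"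
    if "0 < r \<and> r < R powr (1 + \<delta>) \<and> R powr (1 + \<delta>) \<le> R \<and> R < 1" for r R
  proof (rule cINF_greatest)
    fix x assume x: "x \<in> supp \<nu>"
    have "measure \<nu> (ball x r \<inter> space \<nu>) \<le> measure \<nu> (ball x R \<inter> space \<nu>)"
      using that by (intro finite_measure_mono open_Int_cube_sets[OF sets]) auto
    moreover have "0 < measure \<nu> (ball x r \<inter> space \<nu>)"
      using x that by (simp add: supp_def)
    ultimately show "1 * (R / r) powr 0 \<le> measure \<nu> (ball x R \<inter> space \<nu>) / measure \<nu> (ball x r \<inter> space \<nu>)"
      using that by simp
  qed (use x0 in auto)
  then have "ereal 0 \<le> lower_exponent \<nu> \<delta>"
    unfolding lower_exponent_def by (intro Sup_upper) (use zero_less_one in blast)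
  then show ?thesis by (simp add: zero_ereal_def)
qed

text \<open>The condition on \<open>r\<close> lets the ball about any point of the child contain the
  child. The one on \<open>R\<close> keeps the large ball within half a side length of the center of
  \<open>Q \<omega>\<close>, because the closed child contains that center.\<close>

lemma central_child_ball_ratio:
  fixes \<nu> :: "(real ^ 'd::finite) measure"
  assumes Q: "dyadic_labelling Q" and "prob_space \<nu>" and sets: "sets \<nu> = sets cube_borel"
    and w: "\<omega> \<in> words TYPE('d)" "\<omega>' \<in> central_children Q m \<omega>"
    and pos: "0 < measure \<nu> (Q \<omega>')"
    and r: "real CARD('d) / 2 ^ (length \<omega> + m) < r"
    and R: "R + real CARD('d) / 2 ^ (length \<omega> + m) \<le> 1 / (2 * 2 ^ length \<omega>)"
  obtains x where "x \<in> supp \<nu>"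
    "measure \<nu> (ball x R \<inter> space \<nu>) / measure \<nu> (ball x r \<inter> space \<nu>)
      \<le> measure \<nu> (Q \<omega>) / measure \<nu> (Q \<omega>')"
proof -
  interpret prob_space \<nu> by fact
  obtain v where v: "\<omega>' = \<omega> @ v" "v \<in> words TYPE('d)" "length v = m"
    and c: "cube_center (Q \<omega>) \<in> closure (Q \<omega>')"
    using w(2) by (auto simp: central_children_def)
  have w': "\<omega>' \<in> words TYPE('d)"
    using w(1) v by auto
  obtain z where z: "Q \<omega> = dyadic_cube (length \<omega>) z"
    by (rule labelled_cube[OF Q w(1)]) blast
  obtain z' where z': "Q \<omega>' = dyadic_cube (length \<omega>') z'"
    by (rule labelled_cube[OF Q w']) blast
  have QM: "Q \<omega> \<in> sets \<nu>" "Q \<omega>' \<in> sets \<nu>"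
    using labelled_sets[OF Q] w(1) w' by (auto simp: sets)
  obtain x where x: "x \<in> supp \<nu>" "x \<in> Q \<omega>'"
    by (rule supp_meets_non_null[OF finite_measure_axioms sets QM(2) pos])
  have near: "dist x y \<le> real CARD('d) / 2 ^ (length \<omega> + m)" if "y \<in> closure (Q \<omega>')" for y
  proof -
    have "x \<in> closure (Q \<omega>')"
      using x(2) closure_subset by blast
    then have "dist x y \<le> real CARD('d) / 2 ^ length \<omega>'"
      using that unfolding z' by (rule dist_closure_dyadic_cube)
    then show ?thesis
      by (simp add: v(1,3))
  qed
  have "Q \<omega>' \<subseteq> ball x r"
    using near closure_subset r by fastforce
  then have "Q \<omega>' \<subseteq> ball x r \<inter> space \<nu>"
    using sets.sets_into_space[OF QM(2)] by auto
  then have small: "measure \<nu> (Q \<omega>') \<le> measure \<nu> (ball x r \<inter> space \<nu>)"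
    by (intro finite_measure_mono open_Int_cube_sets[OF sets]) auto
  have "ball x R \<subseteq> ball (cube_center (Q \<omega>)) (1 / (2 * 2 ^ length \<omega>))"
  proof
    fix y assume "y \<in> ball x R"
    then show "y \<in> ball (cube_center (Q \<omega>)) (1 / (2 * 2 ^ length \<omega>))"
      using near[OF c] R dist_triangle[of "cube_center (Q \<omega>)" y x] by (simp add: dist_commute)
  qed
  also have "\<dots> \<subseteq> Q \<omega>"
    unfolding z by (rule ball_cube_center)
  finally have large: "measure \<nu> (ball x R \<inter> space \<nu>) \<le> measure \<nu> (Q \<omega>)"
    using QM(1) by (intro finite_measure_mono) auto
  show thesis
    by (rule that[OF x(1)]) (intro frac_le pos small large measure_nonneg)
qed

lemma divide_le_powr:
  fixes a b \<epsilon> :: real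
  assumes "(2 powr - \<epsilon>) ^ m * a \<le> b" "0 < b"
  shows "a / b \<le> 2 powr (\<epsilon> * real m)"
proof -
  have "(2 powr - \<epsilon>) ^ m = 1 / 2 powr (\<epsilon> * real m)"
    by (simp add: powr_minus powr_powr field_simps flip: powr_realpow)
  with assms have "a \<le> b * 2 powr (\<epsilon> * real m)"
    by (simp add: pos_divide_le_eq)
  with assms show ?thesis
    by (simp add: pos_divide_le_eq mult.commute)
qed

text \<open>For infinitely many \<open>m\<close> there are admissible radii with
  \<open>R / r\<close> a constant times \<open>2 ^ m\<close> and mass ratio at most
  \<open>2 powr (\<epsilon> * real m)\<close>, which excludes exponents above
  \<open>\<epsilon>\<close>. Passing from \<open>\<delta>\<close> to \<open>\<delta> / 2\<close>
  leaves room for constants.\<close>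

lemma lower_exponent_le:
  fixes \<nu> :: "(real ^ 'd::finite) measure"
  assumes Q: "dyadic_labelling Q" and "prob_space \<nu>" and sets: "sets \<nu> = sets cube_borel"
    and \<delta>: "0 < \<delta>" and heavy: "\<exists>\<^sub>F m in sequentially. heavy_central Q (2 powr - \<epsilon>) \<delta> m \<nu>"
  shows "lower_exponent \<nu> (\<delta> / 2) \<le> ereal \<epsilon>"
  unfolding lower_exponent_def
proof (rule Sup_least, clarify)
  fix s C :: real
  assume C: "0 < C" and
    scale: "\<forall>r R. 0 < r \<and> r < R powr (1 + \<delta> / 2) \<and> R powr (1 + \<delta> / 2) \<le> R \<and> R < 1 \<longrightarrow>
      C * (R / r) powr s
        \<le> (INF x\<in>supp \<nu>. measure \<nu> (ball x R \<inter> space \<nu>) / measure \<nu> (ball x r \<inter> space \<nu>))"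
  define d where "d = real CARD('d)"
  have d: "0 < d" by (simp add: d_def)
  \<comment> \<open>\<open>m1\<close> makes the child small enough for the large ball to fit into
    \<open>Q \<omega>\<close>; \<open>m2\<close> absorbs the constants in
    \<open>r < R powr (1 + \<delta> / 2)\<close>.\<close>
  have bound: "C * (2 ^ m / (8 * d)) powr s \<le> 2 powr (\<epsilon> * real m)"
    if m: "heavy_central Q (2 powr - \<epsilon>) \<delta> m \<nu>" and m1: "4 * d \<le> 2 ^ m"
      and m2: "2 * d < 2 powr (real m / 2 - 2 - \<delta>)" for m
  proof -
    define l where "l = nat \<lfloor>real m / \<delta>\<rfloor>"
    obtain \<omega> \<omega>' where w: "\<omega> \<in> words TYPE('d)" "length \<omega> = l" "\<omega>' \<in> central_children Q m \<omega>"
      and pos: "0 < measure \<nu> (Q \<omega>')"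
      and ratio: "(2 powr - \<epsilon>) ^ m * measure \<nu> (Q \<omega>) \<le> measure \<nu> (Q \<omega>')"
      using m unfolding heavy_central_def l_def by blast
    \<comment> \<open>\<open>R\<close> is a quarter of the side length of \<open>Q \<omega>\<close>,
      and \<open>r\<close> is twice the diameter bound of the child.\<close>
    define R :: real where "R = 2 powr - (real l + 2)"
    define r where "r = 2 * d / 2 ^ (l + m)"
    have R: "R = 1 / (4 * 2 ^ l)"
      unfolding R_def powr_minus_divide by (simp add: powr_add powr_realpow)
    have r: "r = 2 * d * 2 powr - (real l + real m)"
      unfolding r_def powr_minus_divide by (simp add: powr_add powr_realpow power_add)
    \<comment> \<open>Hence the exponent \<open>1 + \<delta> / 2\<close> costs, up to constants, at
      most a factor \<open>2 powr (m / 2)\<close> in \<open>R\<close>, whereas \<open>r\<close> is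
      smaller by \<open>2 ^ m\<close>.\<close>
    have "l * \<delta> \<le> m"
      using \<delta> by (simp add: l_def flip: pos_le_divide_eq)
    then have "real m / 2 - 2 - \<delta> + - (real l + real m) \<le> - (real l + 2) * (1 + \<delta> / 2)"
      by (simp add: algebra_simps)
    then have "2 powr (real m / 2 - 2 - \<delta>) * 2 powr - (real l + real m) \<le> R powr (1 + \<delta> / 2)"
      unfolding R_def powr_powr powr_add[symmetric] by simp
    moreover have "r < 2 powr (real m / 2 - 2 - \<delta>) * 2 powr - (real l + real m)"
      unfolding r by (intro mult_strict_right_mono m2) simp
    ultimately have r1: "r < R powr (1 + \<delta> / 2)" by linarith
    have "(4::real) * 2 ^ l > 1"
      using one_le_power[of "2::real" l] by linarith
    then have R1: "R < 1" "0 < R"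
      by (auto simp: R)
    then have R2: "R powr (1 + \<delta> / 2) \<le> R"
      using powr_mono'[of 1 "1 + \<delta> / 2" R] \<delta> by simp
    have r0: "0 < r" using d by (simp add: r_def)
    have Rr: "R / r = 2 ^ m / (8 * d)"
      using d by (simp add: R r_def power_add field_simps)
    obtain x where x: "x \<in> supp \<nu>"
      "measure \<nu> (ball x R \<inter> space \<nu>) / measure \<nu> (ball x r \<inter> space \<nu>)
        \<le> measure \<nu> (Q \<omega>) / measure \<nu> (Q \<omega>')"
    proof (rule central_child_ball_ratio[OF Q \<open>prob_space \<nu>\<close> sets w(1,3) pos])
      show "real CARD('d) / 2 ^ (length \<omega> + m) < r"
        using d by (simp add: r_def w(2) d_def divide_strict_right_mono)
      show "R + real CARD('d) / 2 ^ (length \<omega> + m) \<le> 1 / (2 * 2 ^ length \<omega>)"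
        using m1 by (simp add: R w(2) d_def[symmetric] power_add field_simps)
    qed
    have "C * (2 ^ m / (8 * d)) powr s
        \<le> (INF x\<in>supp \<nu>. measure \<nu> (ball x R \<inter> space \<nu>) / measure \<nu> (ball x r \<inter> space \<nu>))"
      using scale r0 r1 R1 R2 by (simp flip: Rr)
    also have "\<dots> \<le> measure \<nu> (ball x R \<inter> space \<nu>) / measure \<nu> (ball x r \<inter> space \<nu>)"
      by (intro cINF_lower x(1) bdd_belowI2[of _ 0]) simp
    also have "\<dots> \<le> measure \<nu> (Q \<omega>) / measure \<nu> (Q \<omega>')"
      by (rule x(2))
    also have "\<dots> \<le> 2 powr (\<epsilon> * real m)"
      using ratio pos by (rule divide_le_powr)
    finally show ?thesis .
  qed
  show "ereal s \<le> ereal \<epsilon>"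
  proof (rule ccontr)
    assume "\<not> ereal s \<le> ereal \<epsilon>"
    then have s: "0 < s - \<epsilon>" by simp
    \<comment> \<open>Above this threshold \<open>2 powr ((s - \<epsilon>) * real m)\<close>
      contradicts the inequality in \<open>bound\<close>.\<close>
    define D where "D = (8 * d) powr s / C"
    have "filterlim (\<lambda>m. 2 powr ((s - \<epsilon>) * real m)) at_top sequentially"
      using s by real_asymp
    then have "\<forall>\<^sub>F m in sequentially. D < 2 powr ((s - \<epsilon>) * real m)"
      by (simp add: filterlim_at_top_dense)
    moreover have "\<forall>\<^sub>F m in sequentially. 4 * d \<le> 2 ^ m"
      by real_asymp
    moreover have "\<forall>\<^sub>F m in sequentially. 2 * d < 2 powr (real m / 2 - 2 - \<delta>)"
      by real_asymp
    ultimately have "\<forall>\<^sub>F m in sequentially. \<not> heavy_central Q (2 powr - \<epsilon>) \<delta> m \<nu>"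
    proof eventually_elim
      case (elim m)
      have "(2 ^ m / (8 * d)) powr s = 2 powr (s * real m) / (8 * d) powr s"
        using d by (simp add: powr_divide powr_powr mult.commute flip: powr_realpow)
      moreover have "2 powr (s * real m) = 2 powr ((s - \<epsilon>) * real m) * 2 powr (\<epsilon> * real m)"
        by (simp add: algebra_simps flip: powr_add)
      moreover have "D * 2 powr (\<epsilon> * real m) < 2 powr ((s - \<epsilon>) * real m) * 2 powr (\<epsilon> * real m)"
        using elim(1) by simp
      moreover have "2 powr (\<epsilon> * real m) = C * (D * 2 powr (\<epsilon> * real m)) / (8 * d) powr s"
        using C d by (simp add: D_def)
      moreover have "0 < (8 * d) powr s"
        using d by simp
      ultimately have "2 powr (\<epsilon> * real m) < C * (2 ^ m / (8 * d)) powr s"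
        using C by (metis divide_strict_right_mono mult_strict_left_mono times_divide_eq_right)
      then show ?case
        using bound[OF _ elim(2,3)] by auto
    qed
    with heavy show False
      by (simp add: frequently_def)
  qed
qed

section \<open>Upper bounds for \<open>h_central\<close>\<close>

lemma finite_central_children: "finite (central_children Q m \<omega>)"
  for Q :: "nat list \<Rightarrow> (real ^ 'd::finite) set"
proof (rule finite_subset)
  show "central_children Q m \<omega> \<subseteq> (\<lambda>v. \<omega> @ v) ` {v \<in> words TYPE('d). length v = m}"
    unfolding central_children_def by blast
qed (intro finite_imageI finite_words_length)

text \<open>\<open>Min\<close> of an empty set carries no information, so bounding
  \<open>h_central\<close> from below needs a central child.\<close>

lemma central_children_nonempty:
  fixes Q :: "nat list \<Rightarrow> (real ^ 'd::finite) set"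
  assumes "dyadic_labelling Q" "\<omega> \<in> words TYPE('d)"
  shows "central_children Q m \<omega> \<noteq> {}"
  using central_path_exists[OF assms, of m] by (auto simp: central_children_def)

text \<open>The heavy child competes in the double minimum, and
  \<open>t = 2 powr - \<epsilon>\<close> makes the logarithm of the bound \<open>1 / t ^ m\<close>
  linear in \<open>m\<close>.\<close>

lemma log2_h_central_le:
  fixes Q :: "nat list \<Rightarrow> (real ^ 'd::finite) set"
  assumes Q: "dyadic_labelling Q" and heavy: "heavy_central Q (2 powr - \<epsilon>) \<delta> m \<nu>" and "0 < m" "0 \<le> \<epsilon>"
  shows "ereal_log2 (h_central Q m \<delta> \<nu>) / ereal (real m) \<le> ereal \<epsilon>"
proof -
  let ?W = "{\<omega> \<in> words TYPE('d). length \<omega> = nat \<lfloor>real m / \<delta>\<rfloor>}"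
  obtain \<omega> \<omega>' where w: "\<omega> \<in> ?W" "\<omega>' \<in> central_children Q m \<omega>"
    and pos: "0 < measure \<nu> (Q \<omega>')"
    and ratio: "(2 powr - \<epsilon>) ^ m * measure \<nu> (Q \<omega>) \<le> measure \<nu> (Q \<omega>')"
    using heavy by (auto simp: heavy_central_def)
  note fin = finite_words_length finite_central_children
  have "h_central Q m \<delta> \<nu> \<le> (MIN \<omega>' \<in> central_children Q m \<omega>. central_ratio Q \<nu> \<omega> \<omega>')"
    unfolding h_central_def using w(1) by (intro Min_le finite_imageI fin) blast
  also have "\<dots> \<le> central_ratio Q \<nu> \<omega> \<omega>'"
    using w(2) by (intro Min_le finite_imageI fin) blast
  also have "\<dots> \<le> ereal (2 powr (\<epsilon> * real m))"
    using divide_le_powr[OF ratio pos] pos by (simp add: central_ratio_def)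
  finally have upper: "h_central Q m \<delta> \<nu> \<le> ereal (2 powr (\<epsilon> * real m))" .
  \<comment> \<open>Nonnegativity rules out \<open>-\<infinity>\<close>; together with
    \<open>upper\<close> it makes \<open>h_central\<close> a real number.\<close>
  have "0 \<le> central_ratio Q \<nu> u u'" for u u'
    by (simp add: central_ratio_def)
  then have "0 \<le> (MIN \<omega>' \<in> central_children Q m u. central_ratio Q \<nu> u \<omega>')" if "u \<in> ?W" for u
    using that central_children_nonempty[OF Q, of u m] by (subst Min_ge_iff) (auto simp: fin)
  then have lower: "0 \<le> h_central Q m \<delta> \<nu>"
    unfolding h_central_def using w(1) by (subst Min_ge_iff) (blast intro: finite_imageI fin)+
  from upper lower obtain y where y: "h_central Q m \<delta> \<nu> = ereal y" "0 \<le> y" "y \<le> 2 powr (\<epsilon> * real m)"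
    by (cases "h_central Q m \<delta> \<nu>") auto
  have "log 2 y \<le> \<epsilon> * real m"
  \<comment> \<open>\<open>\<nu>\<close> is arbitrary here, so \<open>y = 0\<close> is a possible
    case. Then \<open>log 2 0 = 0\<close> by convention, and \<open>0 \<le> \<epsilon>\<close> gives
    the bound.\<close>
  proof (cases "y = 0")
    case False
    with y have "log 2 y \<le> log 2 (2 powr (\<epsilon> * real m))"
      by (subst log_le_cancel_iff) auto
    then show ?thesis by simp
  qed (use \<open>0 \<le> \<epsilon>\<close> in \<open>simp add: log_def\<close>)
  then show ?thesis
    using \<open>0 < m\<close> by (simp add: y(1) ereal_log2_def field_simps)
qed

text \<open>A liminf above \<open>\<epsilon>\<close> would put all late terms above
  \<open>\<epsilon>\<close>, against \<open>log2_h_central_le\<close> at the heavy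
  \<open>m\<close>.\<close>

lemma liminf_log2_h_central_le:
  fixes Q :: "nat list \<Rightarrow> (real ^ 'd::finite) set"
  assumes Q: "dyadic_labelling Q" and "0 \<le> \<epsilon>"
    and heavy: "\<exists>\<^sub>F m in sequentially. heavy_central Q (2 powr - \<epsilon>) \<delta> m \<nu>"
  shows "liminf (\<lambda>m. ereal_log2 (h_central Q m \<delta> \<nu>) / ereal (real m)) \<le> ereal \<epsilon>"
proof (rule ccontr)
  assume "\<not> ?thesis"
  then have "\<forall>\<^sub>F m in sequentially. ereal \<epsilon> < ereal_log2 (h_central Q m \<delta> \<nu>) / ereal (real m)"
    by (intro less_LiminfD) simp
  with eventually_gt_at_top[of 0]
  have "\<forall>\<^sub>F m in sequentially. \<not> heavy_central Q (2 powr - \<epsilon>) \<delta> m \<nu>"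
    by eventually_elim (use log2_h_central_le[OF Q _ _ \<open>0 \<le> \<epsilon>\<close>] in \<open>meson not_le\<close>)
  with heavy show False
    by (simp add: frequently_def)
qed

section \<open>Measurability\<close>

lemma measurable_measure_cube:
  fixes Q :: "nat list \<Rightarrow> (real ^ 'd::finite) set"
  assumes "dyadic_labelling Q" "\<omega> \<in> words TYPE('d)"
  shows "(\<lambda>\<nu>. measure \<nu> (Q \<omega>)) \<in> borel_measurable (prob_algebra cube_borel)"
  unfolding prob_algebra_def
  by (intro measurable_restrict_space1 measurable_measure_subprob_algebra labelled_sets assms)

lemma central_children_words:
  fixes Q :: "nat list \<Rightarrow> (real ^ 'd::finite) set"
  assumes "\<omega> \<in> words TYPE('d)" "\<omega>' \<in> central_children Q m \<omega>"
  shows "\<omega>' \<in> words TYPE('d)"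
  using assms by (auto simp: central_children_def)

text \<open>Transferring the almost sure statement from \<open>M\<close> to the law \<open>P\<close>
  by \<open>AE_distr_iff\<close> requires a measurable event.\<close>

lemma sets_heavy_central:
  fixes Q :: "nat list \<Rightarrow> (real ^ 'd::finite) set"
  assumes Q: "dyadic_labelling Q"
  shows "{\<nu> \<in> space (prob_algebra cube_borel). \<exists>\<^sub>F m in sequentially. heavy_central Q t \<delta> m \<nu>}
    \<in> sets (prob_algebra cube_borel)"
proof -
  have "{\<nu> \<in> space (prob_algebra cube_borel). heavy_central Q t \<delta> m \<nu>}
      \<in> sets (prob_algebra cube_borel)" for m
    unfolding heavy_central_def
  proof (intro sets.sets_Collect_finite_Ex finite_words_length finite_central_children)
    fix \<omega> \<omega>' assume w: "\<omega> \<in> {\<omega> \<in> words TYPE('d). length \<omega> = nat \<lfloor>real m / \<delta>\<rfloor>}"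
      and w': "\<omega>' \<in> central_children Q m \<omega>"
    from w have [measurable]: "(\<lambda>\<nu>. measure \<nu> (Q \<omega>)) \<in> borel_measurable (prob_algebra cube_borel)"
      by (intro measurable_measure_cube[OF Q]) blast
    from w have "\<omega>' \<in> words TYPE('d)"
      by (intro central_children_words[OF _ w']) blast
    then have [measurable]: "(\<lambda>\<nu>. measure \<nu> (Q \<omega>')) \<in> borel_measurable (prob_algebra cube_borel)"
      by (rule measurable_measure_cube[OF Q])
    show "{\<nu> \<in> space (prob_algebra cube_borel). 0 < measure \<nu> (Q \<omega>') \<and>
        t ^ m * measure \<nu> (Q \<omega>) \<le> measure \<nu> (Q \<omega>')} \<in> sets (prob_algebra cube_borel)"
      by measurable
  qed
  then show ?thesis
    unfolding frequently_sequentially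
    by (intro sets.sets_Collect_countable_All sets.sets_Collect_countable_Ex
        sets.sets_Collect_conj sets.sets_Collect_const)
qed

lemma measurable_log2_h_central:
  fixes Q :: "nat list \<Rightarrow> (real ^ 'd::finite) set"
  assumes Q: "dyadic_labelling Q"
  shows "(\<lambda>\<nu>. ereal_log2 (h_central Q m \<delta> \<nu>)) \<in> borel_measurable (prob_algebra cube_borel)"
proof -
  have [measurable]: "ereal_log2 \<in> borel_measurable borel"
    unfolding ereal_log2_def[abs_def] by measurable
  have "h_central Q m \<delta> \<in> borel_measurable (prob_algebra cube_borel)"
    unfolding h_central_def[abs_def]
  proof (intro borel_measurable_Min finite_words_length finite_central_children)
    fix \<omega> \<omega>' assume w: "\<omega> \<in> {\<omega> \<in> words TYPE('d). length \<omega> = nat \<lfloor>real m / \<delta>\<rfloor>}"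
      and w': "\<omega>' \<in> central_children Q m \<omega>"
    from w have [measurable]: "(\<lambda>\<nu>. measure \<nu> (Q \<omega>)) \<in> borel_measurable (prob_algebra cube_borel)"
      by (intro measurable_measure_cube[OF Q]) blast
    from w have "\<omega>' \<in> words TYPE('d)"
      by (intro central_children_words[OF _ w']) blast
    then have [measurable]: "(\<lambda>\<nu>. measure \<nu> (Q \<omega>')) \<in> borel_measurable (prob_algebra cube_borel)"
      by (rule measurable_measure_cube[OF Q])
    show "(\<lambda>\<nu>. central_ratio Q \<nu> \<omega> \<omega>') \<in> borel_measurable (prob_algebra cube_borel)"
      unfolding central_ratio_def by measurable
  qed
  then show ?thesis by measurable
qed

text \<open>Convergence in \<open>ereal\<close> means that liminf and limsup agree, which removes
  the quantifier over uncountably many \<open>L\<close>.\<close>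

lemma sets_Collect_tendsto_pos:
  fixes u :: "nat \<Rightarrow> 'a \<Rightarrow> ereal"
  assumes [measurable]: "\<And>k. u k \<in> borel_measurable M"
  shows "{x \<in> space M. \<exists>L. 0 < L \<and> (\<lambda>k. u k x) \<longlonglongrightarrow> L} \<in> sets M"
proof -
  have "(\<exists>L. 0 < L \<and> (\<lambda>k. u k x) \<longlonglongrightarrow> L) \<longleftrightarrow>
      0 < liminf (\<lambda>k. u k x) \<and> liminf (\<lambda>k. u k x) = limsup (\<lambda>k. u k x)" for x
    by (auto simp: tendsto_iff_Liminf_eq_Limsup)
  then show ?thesis by simp
qed

theorem theorem4p6:
  fixes M :: "'a measure"
    and X :: "nat list \<Rightarrow> 'a \<Rightarrow> nat \<Rightarrow> real"
    and Q :: "nat list \<Rightarrow> (real ^ 'd::finite) set"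
    and \<mu> :: "'a \<Rightarrow> (real ^ 'd) measure"
    and P :: "(real ^ 'd) measure measure"
  assumes "dyadic_labelling Q"
    and "random_cascade M X Q \<mu>"
    and "P = distr M (prob_algebra cube_borel) \<mu>"
  shows "(\<forall>\<delta> :: nat \<Rightarrow> real.
            (\<forall>k. 0 < \<delta> k) \<and> decseq \<delta> \<and> \<delta> \<longlonglongrightarrow> 0 \<longrightarrow>
            {\<nu> \<in> space P. \<exists>L :: ereal. 0 < L \<and>
               (\<lambda>k. liminf (\<lambda>m. ereal_log2 (h_central Q m (\<delta> k) \<nu>) / ereal (real m)))
                 \<longlonglongrightarrow> L} \<in> null_sets P) \<and>
         (AE \<nu> in P. dim_qL \<nu> = 0) \<and>
         (AE \<nu> in P. dim_L \<nu> = 0)"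
proof -
  let ?A = "prob_algebra cube_borel :: (real ^ 'd) measure measure"
  note Q = assms(1)
  \<comment> \<open>A sequence of bounds tending to \<open>0\<close> keeps the intersection of
    almost sure events countable.\<close>
  define \<epsilon> where "\<epsilon> j = 1 / real (Suc j)" for j
  have \<epsilon>: "0 < \<epsilon> j" for j by (simp add: \<epsilon>_def)
  have \<epsilon>_lim: "(\<lambda>j. ereal (\<epsilon> j)) \<longlonglongrightarrow> ereal 0"
    unfolding \<epsilon>_def by (intro tendsto_ereal) real_asymp
  have \<mu>: "\<mu> \<in> M \<rightarrow>\<^sub>M ?A"
    using assms(2) by (simp add: random_cascade_def)
  have P: "space P = space ?A" "sets P = sets ?A"
    by (simp_all add: assms(3))
  have "\<exists>\<delta>0>0. \<forall>\<delta>. 0 < \<delta> \<and> \<delta> \<le> \<delta>0 \<longrightarrow>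
      (AE \<nu> in P. \<exists>\<^sub>F m in sequentially. heavy_central Q (2 powr - \<epsilon> j) \<delta> m \<nu>)" for j
    unfolding assms(3) AE_distr_iff[OF \<mu> sets_heavy_central[OF Q]]
    using \<epsilon>[of j] by (intro AE_frequently_heavy_central[OF Q assms(2)]) (auto simp: powr_less_one)
  then obtain \<delta>0 where \<delta>0: "\<And>j. 0 < \<delta>0 j"
    and heavy: "\<And>j \<delta>. 0 < \<delta> \<Longrightarrow> \<delta> \<le> \<delta>0 j \<Longrightarrow>
      AE \<nu> in P. \<exists>\<^sub>F m in sequentially. heavy_central Q (2 powr - \<epsilon> j) \<delta> m \<nu>"
    by metis
  have "{\<nu> \<in> space P. \<exists>L :: ereal. 0 < L \<and>
      (\<lambda>k. liminf (\<lambda>m. ereal_log2 (h_central Q m (\<delta> k) \<nu>) / ereal (real m))) \<longlonglongrightarrow> L} \<in> null_sets P"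
    if \<delta>: "\<And>k. 0 < \<delta> k" "\<delta> \<longlonglongrightarrow> 0" for \<delta>
  proof -
    let ?E = "\<lambda>\<nu>. \<exists>L :: ereal. 0 < L \<and>
      (\<lambda>k. liminf (\<lambda>m. ereal_log2 (h_central Q m (\<delta> k) \<nu>) / ereal (real m))) \<longlonglongrightarrow> L"
    \<comment> \<open>\<open>heavy\<close> covers only pairs with
      \<open>\<delta> k \<le> \<delta>0 j\<close>; as an implication the statement can be
      intersected over all \<open>j\<close> and \<open>k\<close>.\<close>
    have "AE \<nu> in P. \<delta> k \<le> \<delta>0 j \<longrightarrow>
        (\<exists>\<^sub>F m in sequentially. heavy_central Q (2 powr - \<epsilon> j) (\<delta> k) m \<nu>)" for j k
      using heavy[OF \<delta>(1)[of k], of j] by (cases "\<delta> k \<le> \<delta>0 j") auto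
    then have "AE \<nu> in P. \<forall>j k. \<delta> k \<le> \<delta>0 j \<longrightarrow>
        (\<exists>\<^sub>F m in sequentially. heavy_central Q (2 powr - \<epsilon> j) (\<delta> k) m \<nu>)"
      by (simp add: AE_all_countable)
    then have "AE \<nu> in P. \<not> ?E \<nu>"
    proof eventually_elim
      case (elim \<nu>)
      show ?case
      proof
        assume "?E \<nu>"
        then obtain L :: ereal where L: "0 < L"
          "(\<lambda>k. liminf (\<lambda>m. ereal_log2 (h_central Q m (\<delta> k) \<nu>) / ereal (real m))) \<longlonglongrightarrow> L"
          by blast
        \<comment> \<open>For fixed \<open>j\<close> all but finitely many \<open>\<delta> k\<close>
          lie below \<open>\<delta>0 j\<close>, and a limit ignores the others.\<close>
        have "L \<le> ereal (\<epsilon> j)" for j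
        proof (rule tendsto_upperbound[OF L(2)])
          have "\<forall>\<^sub>F k in sequentially. \<delta> k \<le> \<delta>0 j"
            using order_tendstoD(2)[OF \<delta>(2) \<delta>0[of j]] by (rule eventually_mono) simp
          then show "\<forall>\<^sub>F k in sequentially.
              liminf (\<lambda>m. ereal_log2 (h_central Q m (\<delta> k) \<nu>) / ereal (real m)) \<le> ereal (\<epsilon> j)"
            by eventually_elim (use elim \<epsilon> in \<open>auto intro!: liminf_log2_h_central_le[OF Q less_imp_le]\<close>)
        qed simp
        then have "L \<le> ereal 0"
          by (intro tendsto_lowerbound[OF \<epsilon>_lim]) auto
        with L(1) show False by (simp add: zero_ereal_def)
      qed
    qed
    moreover have "{\<nu> \<in> space P. ?E \<nu>} \<in> sets P"
      unfolding P
      by (intro sets_Collect_tendsto_pos borel_measurable_liminf borel_measurable_ereal_divide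
          measurable_log2_h_central[OF Q] borel_measurable_const)
    ultimately show ?thesis
      by (subst (asm) AE_iff_null) auto
  qed
  moreover have dims: "AE \<nu> in P. dim_qL \<nu> = 0 \<and> dim_L \<nu> = 0"
  proof -
    \<comment> \<open>One value \<open>\<delta>0 j\<close> per \<open>j\<close> is enough for the
      dimensions: \<open>lower_exponent_mono\<close> carries the bound at
      \<open>\<delta>0 j / 2\<close> to the uncountably many smaller
      \<open>\<delta>\<close>.\<close>
    have "AE \<nu> in P. \<forall>j. \<exists>\<^sub>F m in sequentially. heavy_central Q (2 powr - \<epsilon> j) (\<delta>0 j) m \<nu>"
      by (simp add: AE_all_countable heavy \<delta>0)
    then show ?thesis
      using AE_space
    proof eventually_elim
      case (elim \<nu>)
      have \<nu>: "prob_space \<nu>" "sets \<nu> = sets cube_borel"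
        using elim(2) by (auto simp: P space_prob_algebra)
      have upper: "lower_exponent \<nu> \<delta> \<le> ereal (\<epsilon> j)" if "0 \<le> \<delta>" "\<delta> \<le> \<delta>0 j / 2" for j \<delta>
        using lower_exponent_mono[OF that, of \<nu>] lower_exponent_le[OF Q \<nu> \<delta>0[of j], of "\<epsilon> j"] elim(1)
        by (meson order_trans)
      note lower = lower_exponent_nonneg[OF \<nu>(2,1)]
      have "lower_exponent \<nu> 0 \<le> ereal 0"
        using upper[of 0] \<delta>0 by (intro tendsto_lowerbound[OF \<epsilon>_lim]) (auto simp: less_imp_le)
      then have "dim_L \<nu> = 0"
        using lower[of 0] by (simp add: dim_L_def zero_ereal_def[symmetric])
      moreover have "((\<lambda>\<delta>. lower_exponent \<nu> \<delta>) \<longlongrightarrow> 0) (at_right 0)"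
      proof (rule order_tendstoI)
        fix a :: ereal assume "a < 0"
        then show "\<forall>\<^sub>F \<delta> in at_right 0. a < lower_exponent \<nu> \<delta>"
          using lower by (intro always_eventually allI) (rule less_le_trans)
      next
        fix a :: ereal assume "0 < a"
        then have "\<forall>\<^sub>F j in sequentially. ereal (\<epsilon> j) < a"
          using order_tendstoD(2)[OF \<epsilon>_lim] by (simp add: zero_ereal_def)
        then obtain j where j: "ereal (\<epsilon> j) < a"
          by (auto simp: eventually_sequentially)
        have "\<forall>\<^sub>F \<delta> in at_right 0. \<delta> < \<delta>0 j / 2"
          using \<delta>0[of j] by (intro order_tendstoD(2)[OF tendsto_ident_at]) auto
        then show "\<forall>\<^sub>F \<delta> in at_right 0. lower_exponent \<nu> \<delta> < a"
          using eventually_at_right_less[of 0]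
        proof eventually_elim
          case (elim \<delta>)
          then have "lower_exponent \<nu> \<delta> \<le> ereal (\<epsilon> j)"
            by (intro upper) auto
          then show ?case
            using j by (rule le_less_trans)
        qed
      qed
      then have "dim_qL \<nu> = 0"
        unfolding dim_qL_def by (intro tendsto_Lim) auto
      ultimately show ?case by simp
    qed
  qed
  ultimately show ?thesis
    by (auto elim: eventually_mono)
qed

end
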